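(* Let $B\subseteq A$ be an algebra extension (unital associative algebras, $1_B=1_A$) and let $I$ be a two-sided ideal of $A$ with $I\subseteq B$. If $B\subseteq A$ has depth $2n+1$ (respectively depth $2n$), then $B/I\subseteq A/I$ also has depth $2n+1$ (respectively depth $2n$). Moreover, $d(B/I,A/I)\le d(B,A)$.
   Context: Depth: for modules over a ring, $M\mid N$ means $N\cong M\oplus M'$ for some module $M'$, and $M\sim N$ (H-equivalent) means there are natural numbers $r,s\ge 1$ with $N\mid rM$ and $M\mid sN$, where $rM=M\oplus\cdots\oplus M$ ($r$ times). For a unital subring $B\subseteq A$ with $1_B=1_A$, put $C_0(A,B)=B$ (as a $B$-$B$-bimodule) and $C_m(A,B)=A\otimes_B\cdots\otimes_B A$ ($m$ factors $A$) for $m\ge1$, with its natural $A$-$A$-bimodule structure $a(a_1\otimes\cdots\otimes a_m)a'=aa_1\otimes\cdots\otimes a_ma'$ and its restrictions to $A$-$B$-, $B$-$A$-, $B$-$B$-bimodules. The subring $B\subseteq A$ has depth $2m+1$ ($m\ge0$) if $C_{m+1}(A,B)\sim C_m(A,B)$ as $B$-$B$-bimodules; right (resp. left) depth $2m$ ($m\ge1$) if $C_{m+1}(A,B)\sim C_m(A,B)$ as $A$-$B$-bimodules (resp. $B$-$A$-bimodules); depth $2m$ if it has both left and right depth $2m$. Left or right depth $2m$ implies depth $2m+1$, and depth $2m+1$ implies depth $2m+2$. The minimum depth $d(B,A)$ is the least $k\ge 1$ such that $k$ is odd and $B\subseteq A$ has depth $k$, or $k$ is even and $B\subseteq A$ has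 left or right depth $k$; $d(B,A)=\infty$ if there is no such $k$. *)

theory Defs
  imports
    "HOL-Algebra.Free_Abelian_Groups"
    "HOL-Algebra.QuotRing"
    "HOL-Algebra.Subrings"
    "HOL-Algebra.Module"
    "HOL-Library.Extended_Nat"
begin

section \<open>Algebra extensions\<close>

text \<open>The library locale \<^verbatim>\<open>algebra\<close> is restricted to commutative algebras.  Here the
  ground ring is commutative, the algebra itself need not be.\<close>

locale unital_algebra = module K A + A?: ring A
  for K :: "('k, 'c) ring_scheme" and A :: "('k, 'a, 'd) module_scheme" (structure) +
  assumes smult_mult_left:
      "\<lbrakk>c \<in> carrier K; x \<in> carrier A; y \<in> carrier A\<rbrakk>
        \<Longrightarrow> (c \<odot>\<^bsub>A\<^esub> x) \<otimes>\<^bsub>A\<^esub> y = c \<odot>\<^bsub>A\<^esub> (x \<otimes>\<^bsub>A\<^esub> y)"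
    and smult_mult_right:
      "\<lbrakk>c \<in> carrier K; x \<in> carrier A; y \<in> carrier A\<rbrakk>
        \<Longrightarrow> x \<otimes>\<^bsub>A\<^esub> (c \<odot>\<^bsub>A\<^esub> y) = c \<odot>\<^bsub>A\<^esub> (x \<otimes>\<^bsub>A\<^esub> y)"

locale algebra_extension = unital_algebra K A + subring B A
  for K :: "('k, 'c) ring_scheme" and A :: "('k, 'a, 'd) module_scheme" (structure)
    and B :: "'a set" +
  assumes smult_closed_sub: "\<lbrakk>c \<in> carrier K; x \<in> B\<rbrakk> \<Longrightarrow> c \<odot>\<^bsub>A\<^esub> x \<in> B"

abbreviation sub_ring :: "('a, 'd) ring_scheme \<Rightarrow> 'a set \<Rightarrow> ('a, 'd) ring_scheme"
  where "sub_ring A B \<equiv> A\<lparr>carrier := B\<rparr>"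

text \<open>The image of \<^term>\<open>B\<close> in \<^term>\<open>A Quot I\<close>; for \<^prop>\<open>I \<subseteq> B\<close> this is \<open>B/I\<close>.\<close>

definition quot_image :: "('a, 'd) ring_scheme \<Rightarrow> 'a set \<Rightarrow> 'a set \<Rightarrow> 'a set set"
  where "quot_image A B I = (\<lambda>b. I +>\<^bsub>A\<^esub> b) ` B"

section \<open>Bimodules\<close>

text \<open>As with the free Abelian groups of the library, the underlying Abelian group of a bimodule
  is written multiplicatively.  The two rings are not part of the record, so that restriction of
  scalars to a subring leaves the record unchanged.\<close>

record ('r, 's, 'm) bimodule = "'m monoid" +
  lact :: "'r \<Rightarrow> 'm \<Rightarrow> 'm"
  ract :: "'m \<Rightarrow> 's \<Rightarrow> 'm"

abbreviation make_bimodule ::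
  "'m monoid \<Rightarrow> ('r \<Rightarrow> 'm \<Rightarrow> 'm) \<Rightarrow> ('m \<Rightarrow> 's \<Rightarrow> 'm) \<Rightarrow> ('r, 's, 'm) bimodule"
  where "make_bimodule G l r \<equiv> monoid.extend G (bimodule.fields l r)"

locale bimodule = R?: ring R + S?: ring S + M?: comm_group M
  for R :: "('r, 'c) ring_scheme" and S :: "('s, 'd) ring_scheme"
    and M :: "('r, 's, 'm) bimodule" +
  assumes lact_closed: "\<lbrakk>a \<in> carrier R; x \<in> carrier M\<rbrakk> \<Longrightarrow> lact M a x \<in> carrier M"
    and ract_closed: "\<lbrakk>x \<in> carrier M; b \<in> carrier S\<rbrakk> \<Longrightarrow> ract M x b \<in> carrier M"
    and lact_distrib_right: "\<lbrakk>a \<in> carrier R; x \<in> carrier M; y \<in> carrier M\<rbrakk>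
        \<Longrightarrow> lact M a (x \<otimes>\<^bsub>M\<^esub> y) = lact M a x \<otimes>\<^bsub>M\<^esub> lact M a y"
    and lact_distrib_left: "\<lbrakk>a \<in> carrier R; a' \<in> carrier R; x \<in> carrier M\<rbrakk>
        \<Longrightarrow> lact M (a \<oplus>\<^bsub>R\<^esub> a') x = lact M a x \<otimes>\<^bsub>M\<^esub> lact M a' x"
    and lact_assoc: "\<lbrakk>a \<in> carrier R; a' \<in> carrier R; x \<in> carrier M\<rbrakk>
        \<Longrightarrow> lact M (a \<otimes>\<^bsub>R\<^esub> a') x = lact M a (lact M a' x)"
    and lact_one: "x \<in> carrier M \<Longrightarrow> lact M \<one>\<^bsub>R\<^esub> x = x"
    and ract_distrib_left: "\<lbrakk>x \<in> carrier M; y \<in> carrier M; b \<in> carrier S\<rbrakk>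
        \<Longrightarrow> ract M (x \<otimes>\<^bsub>M\<^esub> y) b = ract M x b \<otimes>\<^bsub>M\<^esub> ract M y b"
    and ract_distrib_right: "\<lbrakk>x \<in> carrier M; b \<in> carrier S; b' \<in> carrier S\<rbrakk>
        \<Longrightarrow> ract M x (b \<oplus>\<^bsub>S\<^esub> b') = ract M x b \<otimes>\<^bsub>M\<^esub> ract M x b'"
    and ract_assoc: "\<lbrakk>x \<in> carrier M; b \<in> carrier S; b' \<in> carrier S\<rbrakk>
        \<Longrightarrow> ract M x (b \<otimes>\<^bsub>S\<^esub> b') = ract M (ract M x b) b'"
    and ract_one: "x \<in> carrier M \<Longrightarrow> ract M x \<one>\<^bsub>S\<^esub> = x"
    and lact_ract: "\<lbrakk>a \<in> carrier R; x \<in> carrier M; b \<in> carrier S\<rbrakk>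
        \<Longrightarrow> ract M (lact M a x) b = lact M a (ract M x b)"

definition bimod_isomorphic ::
  "('r, 'c) ring_scheme \<Rightarrow> ('s, 'd) ring_scheme
    \<Rightarrow> ('r, 's, 'm) bimodule \<Rightarrow> ('r, 's, 'n) bimodule \<Rightarrow> bool"
  where "bimod_isomorphic R S M N \<longleftrightarrow>
    (\<exists>f \<in> iso M N.
      (\<forall>a \<in> carrier R. \<forall>x \<in> carrier M. f (lact M a x) = lact N a (f x)) \<and>
      (\<forall>x \<in> carrier M. \<forall>b \<in> carrier S. f (ract M x b) = ract N (f x) b))"

definition bimod_sum ::
  "('r, 's, 'm) bimodule \<Rightarrow> ('r, 's, 'n) bimodule \<Rightarrow> ('r, 's, 'm \<times> 'n) bimodule"
  where "bimod_sum M N = make_bimodule (M \<times>\<times> N)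
    (\<lambda>a (x, y). (lact M a x, lact N a y))
    (\<lambda>(x, y) b. (ract M x b, ract N y b))"

definition bimod_copies :: "nat \<Rightarrow> ('r, 's, 'm) bimodule \<Rightarrow> ('r, 's, nat \<Rightarrow> 'm) bimodule"
  where "bimod_copies r M = make_bimodule (product_group {..<r} (\<lambda>_. M))
    (\<lambda>a x. \<lambda>i\<in>{..<r}. lact M a (x i))
    (\<lambda>x b. \<lambda>i\<in>{..<r}. ract M (x i) b)"

text \<open>\<open>M | N\<close>.  It is no restriction that the complement lives on the type of the
  elements of \<open>N\<close>: any complement is isomorphic to a sub-bimodule of \<open>N\<close>.\<close>

definition bimod_divides ::
  "('r, 'c) ring_scheme \<Rightarrow> ('s, 'd) ring_scheme
    \<Rightarrow> ('r, 's, 'm) bimodule \<Rightarrow> ('r, 's, 'n) bimodule \<Rightarrow> bool"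
  where "bimod_divides R S M N \<longleftrightarrow>
    (\<exists>M' :: ('r, 's, 'n) bimodule. bimodule R S M' \<and> bimod_isomorphic R S N (bimod_sum M M'))"

definition H_equivalent ::
  "('r, 'c) ring_scheme \<Rightarrow> ('s, 'd) ring_scheme
    \<Rightarrow> ('r, 's, 'm) bimodule \<Rightarrow> ('r, 's, 'n) bimodule \<Rightarrow> bool"
  where "H_equivalent R S M N \<longleftrightarrow>
    (\<exists>r \<ge> 1. \<exists>s \<ge> 1.
      bimod_divides R S N (bimod_copies r M) \<and> bimod_divides R S M (bimod_copies s N))"

section \<open>Tensor powers of an extension\<close>

text \<open>The list \<open>[a\<^sub>1, \<dots>, a\<^sub>m]\<close> stands for the generator \<open>a\<^sub>1 \<otimes> \<dots> \<otimes> a\<^sub>m\<close>.\<close>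

definition tensor_free :: "('a, 'd) ring_scheme \<Rightarrow> nat \<Rightarrow> ('a list \<Rightarrow>\<^sub>0 int) monoid"
  where "tensor_free A m = free_Abelian_group {as. length as = m \<and> set as \<subseteq> carrier A}"

inductive_set tensor_rels ::
  "('a, 'd) ring_scheme \<Rightarrow> 'a set \<Rightarrow> nat \<Rightarrow> ('a list \<Rightarrow>\<^sub>0 int) set"
  for A :: "('a, 'd) ring_scheme" and B :: "'a set" and m :: nat
  where
    additive: "\<lbrakk>length us + 1 + length vs = m; set us \<subseteq> carrier A; set vs \<subseteq> carrier A;
        a \<in> carrier A; a' \<in> carrier A\<rbrakk>
      \<Longrightarrow> frag_of (us @ [a \<oplus>\<^bsub>A\<^esub> a'] @ vs) - frag_of (us @ [a] @ vs) - frag_of (us @ [a'] @ vs)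
        \<in> tensor_rels A B m"
  | balanced: "\<lbrakk>length us + 2 + length vs = m; set us \<subseteq> carrier A; set vs \<subseteq> carrier A;
        a \<in> carrier A; a' \<in> carrier A; b \<in> B\<rbrakk>
      \<Longrightarrow> frag_of (us @ [a \<otimes>\<^bsub>A\<^esub> b, a'] @ vs) - frag_of (us @ [a, b \<otimes>\<^bsub>A\<^esub> a'] @ vs)
        \<in> tensor_rels A B m"

definition tensor_null :: "('a, 'd) ring_scheme \<Rightarrow> 'a set \<Rightarrow> nat \<Rightarrow> ('a list \<Rightarrow>\<^sub>0 int) set"
  where "tensor_null A B m = generate (tensor_free A m) (tensor_rels A B m)"

text \<open>\<open>C\<^sub>m(A,B)\<close> for \<open>m \<ge> 1\<close>, defined at once as an \<open>m\<close>-fold tensor product because the type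
  of an iterated binary one would depend on \<open>m\<close>; for \<open>m = 1\<close> this is \<open>A\<close> up to the canonical
  isomorphism.  The value at \<open>m = 0\<close> is not used, see \<open>base_bimodule\<close>.  As in the
  library definition of multiplication in a quotient ring, a union of cosets is taken where
  all the cosets coincide.\<close>

definition tensor_power ::
  "('a, 'd) ring_scheme \<Rightarrow> 'a set \<Rightarrow> nat \<Rightarrow> ('a, 'a, ('a list \<Rightarrow>\<^sub>0 int) set) bimodule"
  where "tensor_power A B m = make_bimodule (tensor_free A m Mod tensor_null A B m)
    (\<lambda>a X. \<Union>x\<in>X. tensor_null A B m #>\<^bsub>tensor_free A m\<^esub>
        frag_extend (\<lambda>as. frag_of ((a \<otimes>\<^bsub>A\<^esub> hd as) # tl as)) x)
    (\<lambda>X a. \<Union>x\<in>X. tensor_null A B m #>\<^bsub>tensor_free A m\<^esub>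
        frag_extend (\<lambda>as. frag_of (butlast as @ [last as \<otimes>\<^bsub>A\<^esub> a])) x)"

text \<open>\<open>C\<^sub>0(A,B) = B\<close>\<close>

definition base_bimodule :: "('a, 'd) ring_scheme \<Rightarrow> 'a set \<Rightarrow> ('a, 'a, 'a) bimodule"
  where "base_bimodule A B =
    make_bimodule \<lparr>carrier = B, mult = add A, one = \<zero>\<^bsub>A\<^esub>\<rparr>
      (\<lambda>b x. b \<otimes>\<^bsub>A\<^esub> x) (\<lambda>x b. x \<otimes>\<^bsub>A\<^esub> b)"

section \<open>Depth\<close>

text \<open>Depth \<open>2m + 1\<close>, for \<open>m \<ge> 0\<close>\<close>

definition has_depth_odd :: "('a, 'd) ring_scheme \<Rightarrow> 'a set \<Rightarrow> nat \<Rightarrow> bool"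
  where "has_depth_odd A B m \<longleftrightarrow>
    (if m = 0
     then H_equivalent (sub_ring A B) (sub_ring A B) (tensor_power A B 1) (base_bimodule A B)
     else H_equivalent (sub_ring A B) (sub_ring A B)
            (tensor_power A B (m + 1)) (tensor_power A B m))"

text \<open>Right, left and two-sided depth \<open>2m\<close>, for \<open>m \<ge> 1\<close>\<close>

definition has_right_depth_even :: "('a, 'd) ring_scheme \<Rightarrow> 'a set \<Rightarrow> nat \<Rightarrow> bool"
  where "has_right_depth_even A B m \<longleftrightarrow>
    m \<ge> 1 \<and> H_equivalent A (sub_ring A B) (tensor_power A B (m + 1)) (tensor_power A B m)"

definition has_left_depth_even :: "('a, 'd) ring_scheme \<Rightarrow> 'a set \<Rightarrow> nat \<Rightarrow> bool"
  where "has_left_depth_even A B m \<longleftrightarrow>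
    m \<ge> 1 \<and> H_equivalent (sub_ring A B) A (tensor_power A B (m + 1)) (tensor_power A B m)"

definition has_depth_even :: "('a, 'd) ring_scheme \<Rightarrow> 'a set \<Rightarrow> nat \<Rightarrow> bool"
  where "has_depth_even A B m \<longleftrightarrow> has_left_depth_even A B m \<and> has_right_depth_even A B m"

text \<open>The infimum of the empty set in \<^typ>\<open>enat\<close> is \<open>\<infinity>\<close>.\<close>

definition min_depth :: "'a set \<Rightarrow> ('a, 'd) ring_scheme \<Rightarrow> enat"
  where "min_depth B A = Inf {enat k | k.
    (\<exists>m. k = 2 * m + 1 \<and> has_depth_odd A B m) \<or>
    (\<exists>m \<ge> 1. k = 2 * m \<and> (has_left_depth_even A B m \<or> has_right_depth_even A B m))}"

end

theory Submission
  imports Defs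
begin

text \<open>\<open>M | N\<close> holds iff the identity of \<open>M\<close> factors through \<open>N\<close>, so H-equivalence is preserved by
  every additive functor.  The functor used here sends \<open>M\<close> to \<open>M / (IM + MI)\<close>.  It maps
  \<open>C\<^sub>m(A,B)\<close> to \<open>C\<^sub>m(A/I,B/I)\<close>: since \<open>I\<close> is an ideal of \<open>A\<close> contained in \<open>B\<close>, a factor from \<open>I\<close>
  in a tensor can be moved to the front, so all tensors with such a factor lie in \<open>I C\<^sub>m(A,B)\<close>.\<close>

section \<open>Bimodule homomorphisms and direct summands\<close>

text \<open>Both sides are divided out because M / IM need not carry a right action of the quotient
  ring. M / (IM + MI) is the largest quotient on which \<open>I\<close> acts as zero from both
  sides, and this one recipe serves every kind of bimodule in the definition of depth. The functor
  is not built from cosets. A locale says when a surjection has kernel IM + MI, so that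
  \<open>C\<^sub>m(A/I,B/I)\<close>, with its own element type, can serve as the value at
  \<open>C\<^sub>m(A,B)\<close>. The work lies in one inclusion: the kernel of the map from
  \<open>C\<^sub>m(A,B)\<close> to \<open>C\<^sub>m(A/I,B/I)\<close> must be no larger than IC + CI.
  In general no ring homomorphism leads back from A/I to A, so the tensor relations of the quotient
  have to be lifted with arbitrary preimages and the errors absorbed in IC + CI.\<close>

definition bimod_hom ::
  "('r, 'c) ring_scheme \<Rightarrow> ('s, 'd) ring_scheme
    \<Rightarrow> ('r, 's, 'm) bimodule \<Rightarrow> ('r, 's, 'n) bimodule \<Rightarrow> ('m \<Rightarrow> 'n) set"
  where "bimod_hom R S M N = {f \<in> hom M N.
    (\<forall>a \<in> carrier R. \<forall>x \<in> carrier M. f (lact M a x) = lact N a (f x)) \<and>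
    (\<forall>x \<in> carrier M. \<forall>b \<in> carrier S. f (ract M x b) = ract N (f x) b)}"

lemma bimod_homI:
  assumes "f \<in> hom M N"
    and "\<And>a x. \<lbrakk>a \<in> carrier R; x \<in> carrier M\<rbrakk> \<Longrightarrow> f (lact M a x) = lact N a (f x)"
    and "\<And>x b. \<lbrakk>x \<in> carrier M; b \<in> carrier S\<rbrakk> \<Longrightarrow> f (ract M x b) = ract N (f x) b"
  shows "f \<in> bimod_hom R S M N"
  using assms by (simp add: bimod_hom_def)

lemma bimod_homD:
  assumes "f \<in> bimod_hom R S M N"
  shows "f \<in> hom M N"
    and "x \<in> carrier M \<Longrightarrow> f x \<in> carrier N"
    and "\<lbrakk>x \<in> carrier M; y \<in> carrier M\<rbrakk> \<Longrightarrow> f (x \<otimes>\<^bsub>M\<^esub> y) = f x \<otimes>\<^bsub>N\<^esub> f y"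
    and "\<lbrakk>a \<in> carrier R; x \<in> carrier M\<rbrakk> \<Longrightarrow> f (lact M a x) = lact N a (f x)"
    and "\<lbrakk>x \<in> carrier M; b \<in> carrier S\<rbrakk> \<Longrightarrow> f (ract M x b) = ract N (f x) b"
  using assms by (auto simp: bimod_hom_def hom_def)

lemma comm_group_extend:
  assumes "comm_group G"
  shows "comm_group (monoid.extend G ext)"
proof -
  interpret comm_group G by fact
  show ?thesis
    by (rule comm_groupI) (auto simp: monoid.defs m_ac intro: l_inv_ex)
qed

section \<open>Elementary consequences of the bimodule axioms\<close>

context bimodule begin

lemma lact_mone: assumes "a \<in> carrier R" shows "lact M a \<one>\<^bsub>M\<^esub> = \<one>\<^bsub>M\<^esub>"
  using lact_distrib_right[OF assms M.one_closed M.one_closed] lact_closed[OF assms M.one_closed]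
  by simp

lemma ract_mone: assumes "b \<in> carrier S" shows "ract M \<one>\<^bsub>M\<^esub> b = \<one>\<^bsub>M\<^esub>"
  using ract_distrib_left[OF M.one_closed M.one_closed assms] ract_closed[OF M.one_closed assms]
  by simp

lemma lact_zero: assumes "x \<in> carrier M" shows "lact M \<zero>\<^bsub>R\<^esub> x = \<one>\<^bsub>M\<^esub>"
  using lact_distrib_left[OF R.zero_closed R.zero_closed assms] lact_closed[OF R.zero_closed assms]
  by simp

lemma ract_zero: assumes "x \<in> carrier M" shows "ract M x \<zero>\<^bsub>S\<^esub> = \<one>\<^bsub>M\<^esub>"
  using ract_distrib_right[OF assms S.zero_closed S.zero_closed] ract_closed[OF assms S.zero_closed]
  by simp

lemma lact_minv:
  assumes "a \<in> carrier R" "x \<in> carrier M"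
  shows "lact M a (inv\<^bsub>M\<^esub> x) = inv\<^bsub>M\<^esub> (lact M a x)"
  using lact_distrib_right[of a "inv\<^bsub>M\<^esub> x" x] assms
  by (metis M.inv_closed M.inv_equality M.l_inv lact_closed lact_mone)

lemma ract_minv:
  assumes "x \<in> carrier M" "b \<in> carrier S"
  shows "ract M (inv\<^bsub>M\<^esub> x) b = inv\<^bsub>M\<^esub> (ract M x b)"
  using ract_distrib_left[of "inv\<^bsub>M\<^esub> x" x b] assms
  by (metis M.inv_closed M.inv_equality M.l_inv ract_closed ract_mone)

end

text \<open>Meant for the passage from \<open>A\<close> to \<open>sub_ring A B\<close>: the
  operations stay the same functions and only the carrier shrinks, so each axiom is an instance of
  the old one.\<close>

lemma bimodule_restrict_scalars:
  assumes "bimodule R S M" "ring R'" "ring S'"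
    and "carrier R' \<subseteq> carrier R" "add R' = add R" "mult R' = mult R" "one R' = one R"
    and "carrier S' \<subseteq> carrier S" "add S' = add S" "mult S' = mult S" "one S' = one S"
  shows "bimodule R' S' M"
proof -
  interpret bimodule R S M by fact
  interpret R': ring R' by fact
  interpret S': ring S' by fact
  note [simp] = assms(5-7,9-11) and [intro] = subsetD[OF assms(4)] subsetD[OF assms(8)]
  show ?thesis
    by unfold_locales
      (auto simp: lact_closed ract_closed lact_distrib_right lact_distrib_left lact_assoc lact_one
        ract_distrib_left ract_distrib_right ract_assoc ract_one lact_ract
        subsetD[OF assms(4)] subsetD[OF assms(8)])
qed

lemma group_hom_bimod_hom:
  assumes "f \<in> bimod_hom R S M N" "bimodule R S M" "bimodule R S N"
  shows "group_hom M N f"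
proof -
  interpret M: bimodule R S M by fact
  interpret N: bimodule R S N by fact
  show ?thesis
    by (simp add: group_hom_def group_hom_axioms_def bimod_homD(1)[OF assms(1)]
        M.M.group_axioms N.M.group_axioms)
qed

text \<open>Provides the complement in the splitting below. Shrinking the carrier of
  \<open>N\<close> keeps its element type, as \<open>bimod_divides\<close> asks of a
  complement.\<close>

lemma bimodule_kernel:
  assumes M: "bimodule R S M" and N: "bimodule R S N" and g: "g \<in> bimod_hom R S N M"
  shows "bimodule R S (N\<lparr>carrier := kernel N M g\<rparr>)"
proof -
  interpret M: bimodule R S M by fact
  interpret N: bimodule R S N by fact
  interpret g: group_hom N M g using group_hom_bimod_hom[OF g N M] .
  let ?K = "N\<lparr>carrier := kernel N M g\<rparr>"
  have "group ?K"
    using subgroup.subgroup_is_group[OF g.subgroup_kernel N.M.group_axioms] .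
  then have "comm_group ?K"
    by (rule group.group_comm_groupI) (auto simp: kernel_def N.M.m_comm)
  then interpret K: comm_group ?K .
  show ?thesis
    by unfold_locales
      (auto simp: kernel_def N.lact_closed N.ract_closed N.lact_distrib_right N.lact_distrib_left
        N.lact_assoc N.lact_one N.ract_distrib_left N.ract_distrib_right N.ract_assoc N.ract_one
        N.lact_ract bimod_homD[OF g] M.lact_mone M.ract_mone)
qed

section \<open>Direct sums and divisibility\<close>

lemma bimod_sum_simps [simp]:
  "carrier (bimod_sum M N) = carrier M \<times> carrier N"
  "(x, y) \<otimes>\<^bsub>bimod_sum M N\<^esub> (x', y') = (x \<otimes>\<^bsub>M\<^esub> x', y \<otimes>\<^bsub>N\<^esub> y')"
  "\<one>\<^bsub>bimod_sum M N\<^esub> = (\<one>\<^bsub>M\<^esub>, \<one>\<^bsub>N\<^esub>)"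
  "lact (bimod_sum M N) a (x, y) = (lact M a x, lact N a y)"
  "ract (bimod_sum M N) (x, y) b = (ract M x b, ract N y b)"
  by (simp_all add: bimod_sum_def monoid.defs bimodule.defs DirProd_def)

lemma bimod_copies_simps [simp]:
  "carrier (bimod_copies r M) = ({..<r} \<rightarrow>\<^sub>E carrier M)"
  "mult (bimod_copies r M) = (\<lambda>x y. \<lambda>i\<in>{..<r}. x i \<otimes>\<^bsub>M\<^esub> y i)"
  "one (bimod_copies r M) = (\<lambda>i\<in>{..<r}. \<one>\<^bsub>M\<^esub>)"
  "lact (bimod_copies r M) a x = (\<lambda>i\<in>{..<r}. lact M a (x i))"
  "ract (bimod_copies r M) x b = (\<lambda>i\<in>{..<r}. ract M (x i) b)"
  by (simp_all add: bimod_copies_def monoid.defs bimodule.defs)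

lemma bimodule_copies:
  assumes "bimodule R S M"
  shows "bimodule R S (bimod_copies r M)"
proof -
  interpret bimodule R S M by fact
  have "comm_group (product_group {..<r} (\<lambda>_. M))"
    by (rule group.group_comm_groupI) (auto simp: M.m_comm PiE_iff)
  then interpret C: comm_group "bimod_copies r M"
    unfolding bimod_copies_def by (rule comm_group_extend)
  show ?thesis
    by unfold_locales
      (auto simp: PiE_iff extensional_def fun_eq_iff lact_closed ract_closed lact_distrib_right
        lact_distrib_left lact_assoc lact_one ract_distrib_left ract_distrib_right ract_assoc
        ract_one lact_ract)
qed

text \<open>From left to right, \<open>f\<close> and \<open>g\<close> are the inclusion and the
  projection of a decomposition. From right to left, \<open>f \<circ> g\<close> is an idempotent
  endomorphism of \<open>N\<close>, and \<open>N\<close> splits into its image, a copy of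
  \<open>M\<close>, and the kernel of \<open>g\<close>.\<close>

lemma bimod_divides_iff_retract:
  fixes M :: "('r, 's, 'm) bimodule" and N :: "('r, 's, 'n) bimodule"
  assumes M: "bimodule R S M" and N: "bimodule R S N"
  shows "bimod_divides R S M N \<longleftrightarrow>
    (\<exists>f \<in> bimod_hom R S M N. \<exists>g \<in> bimod_hom R S N M. \<forall>x \<in> carrier M. g (f x) = x)"
proof
  interpret M: bimodule R S M by fact
  interpret N: bimodule R S N by fact
  {
    assume "bimod_divides R S M N"
    then obtain M' :: "('r, 's, 'n) bimodule" and h where M': "bimodule R S M'"
      and iso: "h \<in> iso N (bimod_sum M M')"
      and hl: "\<And>a x. \<lbrakk>a \<in> carrier R; x \<in> carrier N\<rbrakk> \<Longrightarrow>
        h (lact N a x) = lact (bimod_sum M M') a (h x)"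
      and hr: "\<And>x b. \<lbrakk>x \<in> carrier N; b \<in> carrier S\<rbrakk> \<Longrightarrow>
        h (ract N x b) = ract (bimod_sum M M') (h x) b"
      by (auto simp: bimod_divides_def bimod_isomorphic_def)
    interpret M': bimodule R S M' by fact
    let ?k = "inv_into (carrier N) h"
    have h: "bij_betw h (carrier N) (carrier M \<times> carrier M')"
      and hm: "\<And>x y. \<lbrakk>x \<in> carrier N; y \<in> carrier N\<rbrakk> \<Longrightarrow> h (x \<otimes>\<^bsub>N\<^esub> y) = h x \<otimes>\<^bsub>bimod_sum M M'\<^esub> h y"
      using iso by (auto simp: iso_def hom_def)
    have kc: "?k z \<in> carrier N" and hk: "h (?k z) = z" if "z \<in> carrier M \<times> carrier M'" for z
      using that h by (auto simp: bij_betw_def f_inv_into_f inv_into_into)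
    have keq: "?k z = x" if "x \<in> carrier N" "h x = z" for x z
      using that h by (auto simp: bij_betw_def)
    have hc: "h x \<in> carrier M \<times> carrier M'" if "x \<in> carrier N" for x
      using that h by (auto simp: bij_betw_def)
    \<comment> \<open>The inclusion of the first summand, pulled back along the isomorphism
      \<open>h\<close>.\<close>
    define f where "f x = ?k (x, \<one>\<^bsub>M'\<^esub>)" for x
    have "f \<in> bimod_hom R S M N"
      by (intro bimod_homI homI)
        (auto simp: f_def hm hl hr hk kc N.lact_closed N.ract_closed
          M'.lact_mone M'.ract_mone intro!: keq)
    moreover have "fst \<circ> h \<in> bimod_hom R S N M"
    proof (intro bimod_homI homI)
      fix x y a b assume x: "x \<in> carrier N" and y: "y \<in> carrier N"
      obtain u v u' v' where eq: "h x = (u, v)" "h y = (u', v')" by fastforce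
      show "(fst \<circ> h) x \<in> carrier M" using hc[OF x] by auto
      show "(fst \<circ> h) (x \<otimes>\<^bsub>N\<^esub> y) = (fst \<circ> h) x \<otimes>\<^bsub>M\<^esub> (fst \<circ> h) y"
        using hm[OF x y] by (simp add: eq)
      show "(fst \<circ> h) (lact N a x) = lact M a ((fst \<circ> h) x)" if "a \<in> carrier R"
        using hl[OF that x] by (simp add: eq)
      show "(fst \<circ> h) (ract N x b) = ract M ((fst \<circ> h) x) b" if "b \<in> carrier S"
        using hr[OF x that] by (simp add: eq)
    qed
    moreover have "\<forall>x \<in> carrier M. (fst \<circ> h) (f x) = x"
      by (simp add: f_def hk)
    ultimately show "\<exists>f \<in> bimod_hom R S M N. \<exists>g \<in> bimod_hom R S N M. \<forall>x \<in> carrier M. g (f x) = x"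
      by blast
  next
    assume "\<exists>f \<in> bimod_hom R S M N. \<exists>g \<in> bimod_hom R S N M. \<forall>x \<in> carrier M. g (f x) = x"
    then obtain f g where f: "f \<in> bimod_hom R S M N" and g: "g \<in> bimod_hom R S N M"
      and gf: "\<And>x. x \<in> carrier M \<Longrightarrow> g (f x) = x" by blast
    interpret f: group_hom M N f using group_hom_bimod_hom[OF f M N] .
    interpret g: group_hom N M g using group_hom_bimod_hom[OF g N M] .
    note fD = bimod_homD[OF f] and gD = bimod_homD[OF g]
    let ?K = "N\<lparr>carrier := kernel N M g\<rparr>"
    have K: "bimodule R S ?K" by (rule bimodule_kernel[OF M N g])
    \<comment> \<open>In additive notation y = f (g y) + (y - f (g y)), and \<open>g\<close> kills
      the second part because g (f x) = x. The inverse of \<open>h\<close> sends (x, z) to f x +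
      z.\<close>
    define h where "h y = (g y, y \<otimes>\<^bsub>N\<^esub> inv\<^bsub>N\<^esub> f (g y))" for y
    have hc: "h y \<in> carrier M \<times> kernel N M g" if "y \<in> carrier N" for y
      using that by (simp add: h_def kernel_def fD gD gf)
    have "h \<in> hom N (bimod_sum M ?K)"
    proof (rule homI)
      fix x y assume "x \<in> carrier N" "y \<in> carrier N"
      then show "h (x \<otimes>\<^bsub>N\<^esub> y) = h x \<otimes>\<^bsub>bimod_sum M ?K\<^esub> h y"
        by (simp add: h_def fD gD N.M.inv_mult N.M.m_ac)
    qed (use hc in auto)
    moreover have "bij_betw h (carrier N) (carrier M \<times> kernel N M g)"
    proof (rule bij_betw_byWitness[where f' = "\<lambda>(x, z). f x \<otimes>\<^bsub>N\<^esub> z"])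
      show "\<forall>y\<in>carrier N. (case h y of (x, z) \<Rightarrow> f x \<otimes>\<^bsub>N\<^esub> z) = y"
        by (auto simp: h_def fD gD N.M.m_lcomm[of "f (g _)"])
      show "\<forall>p\<in>carrier M \<times> kernel N M g. h (case p of (x, z) \<Rightarrow> f x \<otimes>\<^bsub>N\<^esub> z) = p"
        by (auto simp: h_def kernel_def fD gD gf N.M.m_comm[of "f _"] N.M.m_assoc)
      show "h ` carrier N \<subseteq> carrier M \<times> kernel N M g"
        using hc by blast
    qed (auto simp: kernel_def fD)
    ultimately have "h \<in> iso N (bimod_sum M ?K)" by (simp add: iso_def)
    moreover have "h (lact N a y) = lact (bimod_sum M ?K) a (h y)"
      if "a \<in> carrier R" "y \<in> carrier N" for a y
      using that by (simp add: h_def gD fD N.lact_distrib_right N.lact_minv)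
    moreover have "h (ract N y b) = ract (bimod_sum M ?K) (h y) b"
      if "b \<in> carrier S" "y \<in> carrier N" for b y
      using that by (simp add: h_def gD fD N.ract_distrib_left N.ract_minv)
    ultimately show "bimod_divides R S M N"
      unfolding bimod_divides_def bimod_isomorphic_def using K by blast
  }
qed

section \<open>Reduction of bimodules modulo an ideal\<close>

text \<open>Single products only; sums enter through \<open>generate\<close>, so that
  \<open>generate M (bimod_ideal_gens I M)\<close> is the subgroup IM + MI.\<close>

definition bimod_ideal_gens :: "'a set \<Rightarrow> ('a, 'a, 'm) bimodule \<Rightarrow> 'm set"
  where "bimod_ideal_gens I M =
    (\<Union>i\<in>I. lact M i ` carrier M) \<union> (\<Union>i\<in>I. (\<lambda>x. ract M x i) ` carrier M)"

text \<open>\<open>M'\<close> is M / (IM + MI) up to isomorphism, described by the projection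
  \<open>\<pi>\<close> and its kernel; scalars act through \<open>q\<close>. Since \<open>M'\<close>
  is a parameter, a tensor power of the quotient extension fits as it stands.\<close>

locale bimod_reduction =
  M: bimodule R S M + M': bimodule R' S' M' + group_hom M M' \<pi>
  for R :: "('a, 'c) ring_scheme" and S :: "('a, 'd) ring_scheme"
    and R' :: "('b, 'e) ring_scheme" and S' :: "('b, 'f) ring_scheme"
    and q :: "'a \<Rightarrow> 'b" and I :: "'a set"
    and M :: "('a, 'a, 'm) bimodule" and M' :: "('b, 'b, 'n) bimodule" and \<pi> :: "'m \<Rightarrow> 'n" +
  assumes ideal_subset: "I \<subseteq> carrier R" "I \<subseteq> carrier S"
    and scalars: "carrier R' = q ` carrier R" "carrier S' = q ` carrier S"
    and surj: "carrier M' = \<pi> ` carrier M"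
    and lact: "\<lbrakk>a \<in> carrier R; x \<in> carrier M\<rbrakk> \<Longrightarrow> \<pi> (lact M a x) = lact M' (q a) (\<pi> x)"
    and ract: "\<lbrakk>x \<in> carrier M; b \<in> carrier S\<rbrakk> \<Longrightarrow> \<pi> (ract M x b) = ract M' (\<pi> x) (q b)"
    and kernel: "kernel M M' \<pi> = generate M (bimod_ideal_gens I M)"

text \<open>This makes the reduction a functor: \<open>f\<close> takes i x to i (f x) and x i to (f
  x) i, so generators of IM + MI go to generators of IN + NI.\<close>

lemma bimod_hom_generate_ideal_gens:
  assumes "bimodule R S M" "bimodule R S N" "I \<subseteq> carrier R" "I \<subseteq> carrier S"
    and f: "f \<in> bimod_hom R S M N" and "x \<in> generate M (bimod_ideal_gens I M)"
  shows "f x \<in> generate N (bimod_ideal_gens I N)"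
proof -
  interpret M: bimodule R S M by fact
  interpret N: bimodule R S N by fact
  interpret group_hom M N f by (rule group_hom_bimod_hom) fact+
  have sub: "bimod_ideal_gens I M \<subseteq> carrier M"
    using assms(3,4) by (auto simp: bimod_ideal_gens_def M.lact_closed M.ract_closed)
  have "f ` bimod_ideal_gens I M \<subseteq> bimod_ideal_gens I N"
    using assms(3,4) by (force simp: bimod_ideal_gens_def bimod_homD[OF f] subset_iff)
  then have "generate N (f ` bimod_ideal_gens I M) \<subseteq> generate N (bimod_ideal_gens I N)"
    by (rule N.M.mono_generate)
  then show ?thesis
    using generate_img[OF sub] assms(6) by blast
qed

text \<open>Homomorphism theorem: \<open>\<rho> \<circ> f\<close> vanishes on the kernel of
  \<open>\<pi>\<close>, because \<open>f\<close> maps IM + MI into IN + NI. Linearity over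
  \<open>R'\<close> and \<open>S'\<close> can be tested on preimages, as \<open>\<pi>\<close> and
  \<open>q\<close> are onto.\<close>

lemma bimod_hom_descends:
  assumes M: "bimod_reduction R S R' S' q I M M' \<pi>" and N: "bimod_reduction R S R' S' q I N N' \<rho>"
    and f: "f \<in> bimod_hom R S M N"
  obtains f' where "f' \<in> bimod_hom R' S' M' N'" "\<And>x. x \<in> carrier M \<Longrightarrow> f' (\<pi> x) = \<rho> (f x)"
proof -
  interpret M: bimod_reduction R S R' S' q I M M' \<pi> by fact
  interpret N: bimod_reduction R S R' S' q I N N' \<rho> by fact
  interpret f: group_hom M N f
    using group_hom_bimod_hom[OF f M.M.bimodule_axioms N.M.bimodule_axioms] .
  note fD = bimod_homD[OF f]
  have wd: "\<rho> (f x) = \<rho> (f y)" if xy: "x \<in> carrier M" "y \<in> carrier M" "\<pi> x = \<pi> y" for x y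
  proof -
    have "x \<otimes>\<^bsub>M\<^esub> inv\<^bsub>M\<^esub> y \<in> kernel M M' \<pi>"
      using xy by (simp add: kernel_def)
    then have "f (x \<otimes>\<^bsub>M\<^esub> inv\<^bsub>M\<^esub> y) \<in> kernel N N' \<rho>"
      unfolding M.kernel N.kernel
      by (rule bimod_hom_generate_ideal_gens[OF M.M.bimodule_axioms N.M.bimodule_axioms
            M.ideal_subset f])
    then have "\<rho> (f x) \<otimes>\<^bsub>N'\<^esub> inv\<^bsub>N'\<^esub> \<rho> (f y) = \<one>\<^bsub>N'\<^esub>"
      using xy by (simp add: kernel_def)
    then show ?thesis
      using xy N.M'.M.inv_solve_right'[of "\<one>\<^bsub>N'\<^esub>" "\<rho> (f x)" "\<rho> (f y)"] by simp
  qed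
  \<comment> \<open>By \<open>wd\<close> the preimage chosen by \<open>inv_into\<close> does not
    affect the value.\<close>
  define f' where "f' y = \<rho> (f (inv_into (carrier M) \<pi> y))" for y
  have f': "f' (\<pi> x) = \<rho> (f x)" if "x \<in> carrier M" for x
    unfolding f'_def using that
    by (intro wd) (auto simp: f_inv_into_f inv_into_into)
  moreover have "f' \<in> bimod_hom R' S' M' N'"
  proof (intro bimod_homI homI)
    fix y z assume "y \<in> carrier M'" "z \<in> carrier M'"
    then obtain u v where "u \<in> carrier M" "v \<in> carrier M" "y = \<pi> u" "z = \<pi> v"
      using M.surj by auto
    then show "f' y \<in> carrier N'" "f' (y \<otimes>\<^bsub>M'\<^esub> z) = f' y \<otimes>\<^bsub>N'\<^esub> f' z"
      by (simp_all add: f' flip: M.hom_mult)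
  next
    fix y a assume "y \<in> carrier M'" "a \<in> carrier R'"
    then obtain u c where "u \<in> carrier M" "c \<in> carrier R" "y = \<pi> u" "a = q c"
      using M.surj M.scalars by auto
    then show "f' (lact M' a y) = lact N' a (f' y)"
      by (simp add: f' fD M.M.lact_closed N.lact flip: M.lact)
  next
    fix y a assume "y \<in> carrier M'" "a \<in> carrier S'"
    then obtain u c where "u \<in> carrier M" "c \<in> carrier S" "y = \<pi> u" "a = q c"
      using M.surj M.scalars by auto
    then show "f' (ract M' y a) = ract N' (f' y) a"
      by (simp add: f' fD M.M.ract_closed N.ract flip: M.ract)
  qed
  ultimately show ?thesis using that by blast
qed

text \<open>The equation g (f x) = x survives the descent, since every element of \<open>M'\<close>
  is some \<open>\<pi> x\<close>; by the retract criterion this is divisibility.\<close>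

lemma bimod_divides_descends:
  assumes M: "bimod_reduction R S R' S' q I M M' \<pi>" and N: "bimod_reduction R S R' S' q I N N' \<rho>"
    and "bimod_divides R S M N"
  shows "bimod_divides R' S' M' N'"
proof -
  interpret M: bimod_reduction R S R' S' q I M M' \<pi> by fact
  interpret N: bimod_reduction R S R' S' q I N N' \<rho> by fact
  obtain f g where f: "f \<in> bimod_hom R S M N" and g: "g \<in> bimod_hom R S N M"
    and gf: "\<And>x. x \<in> carrier M \<Longrightarrow> g (f x) = x"
    using assms(3) bimod_divides_iff_retract[OF M.M.bimodule_axioms N.M.bimodule_axioms] by blast
  obtain f' where f': "f' \<in> bimod_hom R' S' M' N'" "\<And>x. x \<in> carrier M \<Longrightarrow> f' (\<pi> x) = \<rho> (f x)"
    using bimod_hom_descends[OF M N f] by blast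
  obtain g' where g': "g' \<in> bimod_hom R' S' N' M'" "\<And>x. x \<in> carrier N \<Longrightarrow> g' (\<rho> x) = \<pi> (g x)"
    using bimod_hom_descends[OF N M g] by blast
  have "\<forall>y \<in> carrier M'. g' (f' y) = y"
    using M.surj by (auto simp: f' g' gf bimod_homD[OF f])
  then show ?thesis
    using f' g' bimod_divides_iff_retract[OF M.M'.bimodule_axioms N.M'.bimodule_axioms] by blast
qed

text \<open>The easy half of the kernel condition: for i in \<open>I\<close>, the image of i x is q
  i times the image of x, hence zero, and likewise on the right.\<close>

lemma bimod_reduction_kernel_supset:
  assumes "bimodule R S M" "bimodule R' S' M'" "group_hom M M' \<pi>"
    and "I \<subseteq> carrier R" "I \<subseteq> carrier S"
    and "\<And>a x. \<lbrakk>a \<in> carrier R; x \<in> carrier M\<rbrakk> \<Longrightarrow> \<pi> (lact M a x) = lact M' (q a) (\<pi> x)"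
    and "\<And>x b. \<lbrakk>x \<in> carrier M; b \<in> carrier S\<rbrakk> \<Longrightarrow> \<pi> (ract M x b) = ract M' (\<pi> x) (q b)"
    and "\<And>i. i \<in> I \<Longrightarrow> q i = \<zero>\<^bsub>R'\<^esub> \<and> q i = \<zero>\<^bsub>S'\<^esub>"
  shows "generate M (bimod_ideal_gens I M) \<subseteq> kernel M M' \<pi>"
proof -
  interpret M: bimodule R S M by fact
  interpret M': bimodule R' S' M' by fact
  interpret group_hom M M' \<pi> by fact
  have "\<pi> (lact M i x) = \<one>\<^bsub>M'\<^esub>" "\<pi> (ract M x i) = \<one>\<^bsub>M'\<^esub>"
    if "i \<in> I" "x \<in> carrier M" for i x
    using that assms(4,5,8) M'.lact_zero[of "\<pi> x"] M'.ract_zero[of "\<pi> x"]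
    by (metis assms(6) hom_closed subsetD, metis assms(7) hom_closed subsetD)
  then have "bimod_ideal_gens I M \<subseteq> kernel M M' \<pi>"
    using assms(4,5) by (auto simp: bimod_ideal_gens_def kernel_def M.lact_closed M.ract_closed)
  then show ?thesis
    by (rule M.M.generate_subgroup_incl[OF _ subgroup_kernel])
qed

text \<open>Additivity of the functor. The projection acts coordinatewise, so a family in its kernel
  has all coordinates in IM + MI, and it is the sum of its one-coordinate parts.\<close>

lemma bimod_reduction_copies:
  assumes "bimod_reduction R S R' S' q I M M' \<pi>"
  shows "bimod_reduction R S R' S' q I (bimod_copies r M) (bimod_copies r M')
    (\<lambda>x. \<lambda>i\<in>{..<r}. \<pi> (x i))"
proof -
  interpret bimod_reduction R S R' S' q I M M' \<pi> by fact
  let ?C = "bimod_copies r M" and ?C' = "bimod_copies r M'" and ?\<pi> = "\<lambda>x. \<lambda>i\<in>{..<r}. \<pi> (x i)"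
  let ?J = "generate ?C (bimod_ideal_gens I ?C)"
  interpret C: bimodule R S ?C by (rule bimodule_copies[OF M.bimodule_axioms])
  interpret C': bimodule R' S' ?C' by (rule bimodule_copies[OF M'.bimodule_axioms])
  interpret p: group_hom ?C ?C' ?\<pi>
    by unfold_locales (auto simp: hom_def PiE_iff fun_eq_iff)
  have surj': "carrier ?C' = ?\<pi> ` carrier ?C"
  proof (intro equalityI subsetI)
    fix y assume y: "y \<in> carrier ?C'"
    define x where "x = (\<lambda>i\<in>{..<r}. inv_into (carrier M) \<pi> (y i))"
    have "y i \<in> \<pi> ` carrier M" if "i < r" for i
      using that y surj by (auto simp: PiE_iff)
    then have "x \<in> carrier ?C" "y = ?\<pi> x"
      using y by (auto simp: x_def PiE_iff extensional_def fun_eq_iff f_inv_into_f inv_into_into)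
    then show "y \<in> ?\<pi> ` carrier ?C" by blast
  qed (use p.hom_closed in blast)
  have l: "?\<pi> (lact ?C a x) = lact ?C' (q a) (?\<pi> x)" if "a \<in> carrier R" "x \<in> carrier ?C" for a x
    using that by (auto simp: PiE_iff fun_eq_iff lact)
  have r: "?\<pi> (ract ?C x b) = ract ?C' (?\<pi> x) (q b)" if "x \<in> carrier ?C" "b \<in> carrier S" for x b
    using that by (auto simp: PiE_iff fun_eq_iff ract)
  have "kernel ?C ?C' ?\<pi> = ?J"
  proof
    \<comment> \<open>The embedding of \<open>M\<close> as the \<open>k\<close>-th coordinate; being
      a bimodule homomorphism, it maps IM + MI into \<open>?J\<close>.\<close>
    let ?e = "\<lambda>k x. \<lambda>i\<in>{..<r}. if i = k then x else \<one>\<^bsub>M\<^esub>"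
    have e: "?e k \<in> bimod_hom R S M ?C" for k
      by (intro bimod_homI homI)
        (auto simp: fun_eq_iff M.lact_mone M.ract_mone)
    \<comment> \<open>Induction over truncations: passing from \<open>k\<close> to
      \<open>Suc k\<close> adds the \<open>k\<close>-th coordinate, and from \<open>r\<close> on
      nothing changes.\<close>
    have "(\<lambda>i\<in>{..<r}. if i < k then x i else \<one>\<^bsub>M\<^esub>) \<in> ?J"
      if x: "x \<in> kernel ?C ?C' ?\<pi>" for x k
    proof (induction k)
      case 0
      then show ?case using generate.one[of ?C "bimod_ideal_gens I ?C"] by (simp add: restrict_def)
    next
      case (Suc k)
      show ?case
      proof (cases "k < r")
        case True
        have "x i \<in> carrier M" if "i < r" for i
          using x that by (auto simp: kernel_def)
        then have "(\<lambda>i\<in>{..<r}. if i < Suc k then x i else \<one>\<^bsub>M\<^esub>) =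
            (\<lambda>i\<in>{..<r}. if i < k then x i else \<one>\<^bsub>M\<^esub>) \<otimes>\<^bsub>?C\<^esub> ?e k (x k)"
          by (auto simp: fun_eq_iff)
        moreover have "?\<pi> x k = (\<lambda>i\<in>{..<r}. \<one>\<^bsub>M'\<^esub>) k"
          using x by (simp only: kernel_def bimod_copies_simps mem_Collect_eq)
        then have "x k \<in> kernel M M' \<pi>"
          using x True by (auto simp: kernel_def)
        then have "?e k (x k) \<in> ?J"
          unfolding kernel
          by (rule bimod_hom_generate_ideal_gens[OF M.bimodule_axioms C.bimodule_axioms
                ideal_subset e])
        ultimately show ?thesis
          by (simp only: generate.eng[OF Suc.IH])
      next
        case False
        then have "(\<lambda>i\<in>{..<r}. if i < Suc k then x i else \<one>\<^bsub>M\<^esub>) =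
            (\<lambda>i\<in>{..<r}. if i < k then x i else \<one>\<^bsub>M\<^esub>)"
          by (auto simp: fun_eq_iff)
        then show ?thesis using Suc.IH by simp
      qed
    qed
    note * = this[where k = r]
    show "kernel ?C ?C' ?\<pi> \<subseteq> ?J"
    proof
      fix x assume x: "x \<in> kernel ?C ?C' ?\<pi>"
      then have "(\<lambda>i\<in>{..<r}. if i < r then x i else \<one>\<^bsub>M\<^esub>) = x"
        by (auto simp: kernel_def fun_eq_iff PiE_iff extensional_def)
      then show "x \<in> ?J" using *[OF x] by simp
    qed
    \<comment> \<open>The locale does not state q i = 0, so it is from the kernel condition for
      \<open>M\<close> that \<open>\<pi>\<close> is seen to kill the generators.\<close>
    have mem: "\<pi> x = \<one>\<^bsub>M'\<^esub>" if "x \<in> bimod_ideal_gens I M" for x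
      using generate.incl[OF that, of M] by (auto simp: kernel_def simp flip: kernel)
    have "bimod_ideal_gens I ?C \<subseteq> kernel ?C ?C' ?\<pi>"
    proof
      fix x assume x: "x \<in> bimod_ideal_gens I ?C"
      then have "x \<in> carrier ?C"
        using ideal_subset C.lact_closed C.ract_closed unfolding bimod_ideal_gens_def by blast
      moreover have "x i \<in> bimod_ideal_gens I M" if "i < r" for i
        using x that by (fastforce simp: bimod_ideal_gens_def)
      ultimately show "x \<in> kernel ?C ?C' ?\<pi>"
        using mem by (simp add: kernel_def fun_eq_iff)
    qed
    then show "?J \<subseteq> kernel ?C ?C' ?\<pi>"
      by (rule C.M.generate_subgroup_incl[OF _ p.subgroup_kernel])
  qed
  then show ?thesis
    using surj' l r ideal_subset scalars by unfold_locales auto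
qed

text \<open>The subgroup IM + MI depends on \<open>I\<close> and not on the rings acting, so the
  kernel condition carries over unchanged once \<open>I\<close> lies in the smaller rings.\<close>

lemma bimod_reduction_restrict_scalars:
  assumes "bimod_reduction R S R' S' q I M M' \<pi>"
    and "ring R1" "ring S1" "ring R1'" "ring S1'" "I \<subseteq> carrier R1" "I \<subseteq> carrier S1"
    and "carrier R1' = q ` carrier R1" "carrier S1' = q ` carrier S1"
    and "carrier R1 \<subseteq> carrier R" "add R1 = add R" "mult R1 = mult R" "one R1 = one R"
    and "carrier S1 \<subseteq> carrier S" "add S1 = add S" "mult S1 = mult S" "one S1 = one S"
    and "add R1' = add R'" "mult R1' = mult R'" "one R1' = one R'"
    and "add S1' = add S'" "mult S1' = mult S'" "one S1' = one S'"
  shows "bimod_reduction R1 S1 R1' S1' q I M M' \<pi>"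
proof -
  interpret bimod_reduction R S R' S' q I M M' \<pi> by fact
  interpret r: bimodule R1 S1 M
    using assms(2-17) by (intro bimodule_restrict_scalars[OF M.bimodule_axioms])
  interpret r': bimodule R1' S1' M'
    using assms(2-23) scalars by (intro bimodule_restrict_scalars[OF M'.bimodule_axioms]) auto
  show ?thesis
    using assms(2-23) surj kernel by unfold_locales (auto simp: lact ract subset_iff)
qed

text \<open>The multiplicities \<open>r\<close> and \<open>s\<close> stay the same, as reduction
  commutes with finite copies.\<close>

lemma H_equivalent_descends:
  assumes "bimod_reduction R S R' S' q I M M' \<pi>" "bimod_reduction R S R' S' q I N N' \<rho>"
    and "H_equivalent R S M N"
  shows "H_equivalent R' S' M' N'"
  using assms unfolding H_equivalent_def
  by (meson bimod_divides_descends bimod_reduction_copies)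

section \<open>Tensor powers\<close>

abbreviation tensor_words :: "('a, 'd) ring_scheme \<Rightarrow> nat \<Rightarrow> 'a list set"
  where "tensor_words A m \<equiv> {as. length as = m \<and> set as \<subseteq> carrier A}"

definition tensor_class ::
  "('a, 'd) ring_scheme \<Rightarrow> 'a set \<Rightarrow> nat \<Rightarrow> ('a list \<Rightarrow>\<^sub>0 int) \<Rightarrow> ('a list \<Rightarrow>\<^sub>0 int) set"
  where "tensor_class A B m x = tensor_null A B m #>\<^bsub>tensor_free A m\<^esub> x"

text \<open>This and \<open>tensor_rmult\<close> are the maps on representatives from which
  \<open>tensor_power\<close> builds its two actions.\<close>

definition tensor_lmult :: "('a, 'd) ring_scheme \<Rightarrow> 'a \<Rightarrow> ('a list \<Rightarrow>\<^sub>0 int) \<Rightarrow> ('a list \<Rightarrow>\<^sub>0 int)"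
  where "tensor_lmult A a = frag_extend (\<lambda>as. frag_of ((a \<otimes>\<^bsub>A\<^esub> hd as) # tl as))"

definition tensor_rmult :: "('a, 'd) ring_scheme \<Rightarrow> 'a \<Rightarrow> ('a list \<Rightarrow>\<^sub>0 int) \<Rightarrow> ('a list \<Rightarrow>\<^sub>0 int)"
  where "tensor_rmult A a = frag_extend (\<lambda>as. frag_of (butlast as @ [last as \<otimes>\<^bsub>A\<^esub> a]))"

lemma tensor_mult_frag_of [simp]:
  "tensor_lmult A a (frag_of as) = frag_of ((a \<otimes>\<^bsub>A\<^esub> hd as) # tl as)"
  "tensor_rmult A a (frag_of as) = frag_of (butlast as @ [last as \<otimes>\<^bsub>A\<^esub> a])"
  by (simp_all add: tensor_lmult_def tensor_rmult_def)

lemma tensor_mult_zero [simp]: "tensor_lmult A a 0 = 0" "tensor_rmult A a 0 = 0"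
  by (simp_all add: tensor_lmult_def tensor_rmult_def)

lemma tensor_mult_diff:
  "tensor_lmult A a (x - y) = tensor_lmult A a x - tensor_lmult A a y"
  "tensor_rmult A a (x - y) = tensor_rmult A a x - tensor_rmult A a y"
  by (simp_all add: tensor_lmult_def tensor_rmult_def frag_extend_diff)

lemma tensor_mult_add:
  "tensor_lmult A a (x + y) = tensor_lmult A a x + tensor_lmult A a y"
  "tensor_rmult A a (x + y) = tensor_rmult A a x + tensor_rmult A a y"
  by (simp_all add: tensor_lmult_def tensor_rmult_def frag_extend_add)

lemma keys_diff_subset:
  "\<lbrakk>Poly_Mapping.keys x \<subseteq> S; Poly_Mapping.keys y \<subseteq> S\<rbrakk>
    \<Longrightarrow> Poly_Mapping.keys (x - y) \<subseteq> S"
  using keys_diff[of x y] by blast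

lemma keys_frag_extend_subset:
  assumes "Poly_Mapping.keys x \<subseteq> S" and "\<And>a. a \<in> S \<Longrightarrow> Poly_Mapping.keys (f a) \<subseteq> T"
  shows "Poly_Mapping.keys (frag_extend f x) \<subseteq> T"
  using keys_frag_extend[of f x] assms by blast

lemma carrier_tensor_free:
  "carrier (tensor_free A m) = {x. Poly_Mapping.keys x \<subseteq> tensor_words A m}"
  by (simp add: tensor_free_def set_eq_iff)

lemma tensor_free_comm_group: "comm_group (tensor_free A m)"
  by (simp add: tensor_free_def abelian_free_Abelian_group)

text \<open>With \<open>m_pos\<close> words are nonempty, so \<open>hd\<close> and
  \<open>last\<close> in the two actions are genuine tensor factors.\<close>

locale tensor_extension = ring A + subring B A
  for A :: "('a, 'd) ring_scheme" (structure) and B :: "'a set" +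
  fixes m :: nat
  assumes m_pos: "0 < m"
begin

abbreviation "F \<equiv> tensor_free A m"
abbreviation "N \<equiv> tensor_null A B m"
abbreviation "cls \<equiv> tensor_class A B m"
abbreviation "T \<equiv> tensor_power A B m"

lemma B_sub: "b \<in> B \<Longrightarrow> b \<in> carrier A"
  using subset by blast

section \<open>The free group on words and its subgroup of relations\<close>

lemma frag_of_closed_F [simp]: "frag_of as \<in> carrier F \<longleftrightarrow> as \<in> tensor_words A m"
  by (simp add: carrier_tensor_free)

lemma zero_closed_F [simp]: "0 \<in> carrier F"
  by (simp add: carrier_tensor_free)

lemma diff_closed_F: "\<lbrakk>x \<in> carrier F; y \<in> carrier F\<rbrakk> \<Longrightarrow> x - y \<in> carrier F"
  unfolding carrier_tensor_free mem_Collect_eq by (rule keys_diff_subset)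

lemma rels_subset: "tensor_rels A B m \<subseteq> carrier F"
proof
  fix x assume "x \<in> tensor_rels A B m"
  then show "x \<in> carrier F"
    by cases (simp_all add: B_sub diff_closed_F)
qed

lemma null_subgroup: "subgroup N F"
proof -
  interpret F: comm_group F by (rule tensor_free_comm_group)
  show ?thesis
    unfolding tensor_null_def by (rule F.generate_is_subgroup[OF rels_subset])
qed

lemma null_subset: "x \<in> N \<Longrightarrow> x \<in> carrier F"
  using subgroup.mem_carrier[OF null_subgroup] .

lemma null_rels: "x \<in> tensor_rels A B m \<Longrightarrow> x \<in> N"
  by (simp add: tensor_null_def generate.incl)

lemma null_zero [simp]: "0 \<in> N"
  using subgroup.one_closed[OF null_subgroup] by (simp add: tensor_free_def)

lemma null_diff: "\<lbrakk>x \<in> N; y \<in> N\<rbrakk> \<Longrightarrow> x - y \<in> N"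
  using subgroup.m_closed[OF null_subgroup, of x "- y"] subgroup.m_inv_closed[OF null_subgroup, of y]
    null_subset[of y]
  by (simp add: tensor_free_def)

lemma null_add: "\<lbrakk>x \<in> N; y \<in> N\<rbrakk> \<Longrightarrow> x + y \<in> N"
  using null_diff[of x "0 - y"] null_diff[of 0 y] by simp

lemma null_additive:
  assumes "length us + 1 + length vs = m" "set us \<subseteq> carrier A" "set vs \<subseteq> carrier A"
    and "a \<in> carrier A" "a' \<in> carrier A"
  shows "frag_of (us @ [a \<oplus> a'] @ vs) - frag_of (us @ [a] @ vs) - frag_of (us @ [a'] @ vs) \<in> N"
  using assms by (intro null_rels tensor_rels.additive)

lemma null_balanced:
  assumes "length us + 2 + length vs = m" "set us \<subseteq> carrier A" "set vs \<subseteq> carrier A"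
    and "a \<in> carrier A" "a' \<in> carrier A" "b \<in> B"
  shows "frag_of (us @ [a \<otimes> b, a'] @ vs) - frag_of (us @ [a, b \<otimes> a'] @ vs) \<in> N"
  using assms by (intro null_rels tensor_rels.balanced)

text \<open>An inverse is 0 - h and a sum is x - (0 - y), so closure under differences covers both
  closure steps of \<open>generate\<close>.\<close>

lemma null_induct [consumes 1, case_names zero rel diff]:
  assumes "x \<in> N" and "P 0" and "\<And>x. x \<in> tensor_rels A B m \<Longrightarrow> P x"
    and diff: "\<And>x y. \<lbrakk>P x; P y\<rbrakk> \<Longrightarrow> P (x - y)"
  shows "P x"
  using assms(1) unfolding tensor_null_def
proof (induction rule: generate.induct)
  case one
  then show ?case using assms(2) by (simp add: tensor_free_def)
next
  case (incl h)
  then show ?case by (rule assms(3))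
next
  case (inv h)
  then have "inv\<^bsub>F\<^esub> h = 0 - h"
    using rels_subset by (auto simp: tensor_free_def)
  then show ?case using diff[OF assms(2) assms(3)[OF inv]] by simp
next
  case (eng x y)
  then show ?case using diff[of x "0 - y"] diff[OF assms(2), of y] by (simp add: tensor_free_def)
qed

lemma free_induct [consumes 1, case_names zero word diff]:
  assumes "x \<in> carrier F" and "P 0" and "\<And>as. as \<in> tensor_words A m \<Longrightarrow> P (frag_of as)"
    and "\<And>x y. \<lbrakk>P x; P y\<rbrakk> \<Longrightarrow> P (x - y)"
  shows "P x"
proof -
  have "Poly_Mapping.keys x \<subseteq> tensor_words A m"
    using assms(1) by (simp add: carrier_tensor_free)
  then show ?thesis by (rule frag_induction) (use assms in auto)
qed

lemma word_cases:
  assumes "as \<in> tensor_words A m"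
  obtains a bs where "as = a # bs" "a \<in> carrier A" "set bs \<subseteq> carrier A" "length bs = m - 1"
  using assms m_pos by (cases as) auto

lemma word_snoc_cases:
  assumes "as \<in> tensor_words A m"
  obtains a bs where "as = bs @ [a]" "a \<in> carrier A" "set bs \<subseteq> carrier A" "length bs = m - 1"
  using assms m_pos by (cases as rule: rev_cases) auto

lemma word_parts:
  assumes "as \<in> tensor_words A m"
  shows "as \<noteq> []" "hd as \<in> carrier A" "last as \<in> carrier A"
    "set (tl as) \<subseteq> carrier A" "set (butlast as) \<subseteq> carrier A"
proof -
  show ne: "as \<noteq> []" using assms m_pos by auto
  have "hd as \<in> set as" "last as \<in> set as" "set (tl as) \<subseteq> set as" "set (butlast as) \<subseteq> set as"
    using ne by (auto simp: list.set_sel dest: in_set_butlastD)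
  then show "hd as \<in> carrier A" "last as \<in> carrier A"
    "set (tl as) \<subseteq> carrier A" "set (butlast as) \<subseteq> carrier A"
    using assms by auto
qed

section \<open>Left and right multiplication on the free group\<close>

lemma lmult_closed:
  assumes "a \<in> carrier A" "x \<in> carrier F" shows "tensor_lmult A a x \<in> carrier F"
  using assms(2)
proof (induction rule: free_induct)
  case (word as)
  then show ?case using word_parts[OF word] assms(1) m_pos by simp
qed (simp_all add: tensor_mult_diff diff_closed_F)

lemma rmult_closed:
  assumes "a \<in> carrier A" "x \<in> carrier F" shows "tensor_rmult A a x \<in> carrier F"
  using assms(2)
proof (induction rule: free_induct)
  case (word as)
  then show ?case using word_parts[OF word] assms(1) m_pos by simp
qed (simp_all add: tensor_mult_diff diff_closed_F)

text \<open>A relation becomes a relation of the same kind. If it involves the first factor, this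
  rests on distributivity or on a (c b) = (a c) b; otherwise only the first entry of
  \<open>us\<close> is multiplied.\<close>

lemma lmult_null:
  assumes a: "a \<in> carrier A" and "x \<in> N" shows "tensor_lmult A a x \<in> N"
  using assms(2)
proof (induction rule: null_induct)
  case (rel x)
  then show ?case
  proof cases
    case (additive us vs c c')
    show ?thesis
    proof (cases us)
      case Nil
      then show ?thesis
        using additive a null_additive[of "[]" vs "a \<otimes> c" "a \<otimes> c'"]
        by (simp add: tensor_mult_diff r_distr)
    next
      case (Cons u us')
      then show ?thesis
        using additive a null_additive[of "(a \<otimes> u) # us'" vs c c']
        by (simp add: tensor_mult_diff)
    qed
  next
    case (balanced us vs c c' b)
    show ?thesis
    proof (cases us)
      case Nil
      then show ?thesis
        using balanced a null_balanced[of "[]" vs "a \<otimes> c" c' b]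
        by (simp add: tensor_mult_diff m_assoc B_sub)
    next
      case (Cons u us')
      then show ?thesis
        using balanced a null_balanced[of "(a \<otimes> u) # us'" vs c c' b]
        by (simp add: tensor_mult_diff)
    qed
  qed
qed (simp_all add: tensor_mult_diff null_diff)

lemma rmult_null:
  assumes a: "a \<in> carrier A" and "x \<in> N" shows "tensor_rmult A a x \<in> N"
  using assms(2)
proof (induction rule: null_induct)
  case (rel x)
  then show ?case
  proof cases
    case (additive us vs c c')
    show ?thesis
    proof (cases vs rule: rev_cases)
      case Nil
      then show ?thesis
        using additive a null_additive[of us "[]" "c \<otimes> a" "c' \<otimes> a"]
        by (simp add: tensor_mult_diff l_distr butlast_append)
    next
      case (snoc vs' v)
      then show ?thesis
        using additive a null_additive[of us "vs' @ [v \<otimes> a]" c c']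
        by (simp add: tensor_mult_diff butlast_append)
    qed
  next
    case (balanced us vs c c' b)
    show ?thesis
    proof (cases vs rule: rev_cases)
      case Nil
      then show ?thesis
        using balanced a null_balanced[of us "[]" c "c' \<otimes> a" b]
        by (simp add: tensor_mult_diff m_assoc B_sub butlast_append)
    next
      case (snoc vs' v)
      then show ?thesis
        using balanced a null_balanced[of us "vs' @ [v \<otimes> a]" c c' b]
        by (simp add: tensor_mult_diff butlast_append)
    qed
  qed
qed (simp_all add: tensor_mult_diff null_diff)

section \<open>Cosets of the relations and the bimodule they form\<close>

lemma cls_eq: "cls x = {n + x | n. n \<in> N}"
  by (auto simp: tensor_class_def r_coset_def tensor_free_def)

lemma cls_eq_iff: "cls x = cls y \<longleftrightarrow> x - y \<in> N"
proof
  assume "cls x = cls y"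
  moreover have "0 + x \<in> cls x" unfolding cls_eq using null_zero by blast
  ultimately obtain n where "n \<in> N" "x = n + y" by (auto simp: cls_eq)
  then show "x - y \<in> N" by simp
next
  assume xy: "x - y \<in> N"
  have "n + x = (n + (x - y)) + y" "n + y = (n - (x - y)) + x" for n by simp_all
  then show "cls x = cls y"
    unfolding cls_eq using null_add[OF _ xy] null_diff[OF _ xy] by blast
qed

lemma cls_mem: "y \<in> cls x \<longleftrightarrow> y - x \<in> N"
  by (force simp: cls_eq)

lemma carrier_T: "carrier T = cls ` carrier F"
  by (simp add: tensor_power_def monoid.defs carrier_FactGroup tensor_class_def)

lemma mult_T:
  assumes "x \<in> carrier F" "y \<in> carrier F"
  shows "cls x \<otimes>\<^bsub>T\<^esub> cls y = cls (x + y)"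
proof -
  interpret F: comm_group F by (rule tensor_free_comm_group)
  interpret N: normal N F
    using null_subgroup by (simp add: F.normal_iff_subgroup)
  show ?thesis
    using N.rcos_sum[OF assms]
    by (simp add: tensor_power_def monoid.defs tensor_class_def tensor_free_def)
qed

lemma one_T: "\<one>\<^bsub>T\<^esub> = cls 0"
  by (simp add: tensor_power_def monoid.defs FactGroup_def cls_eq)

text \<open>The union in \<open>tensor_power\<close> runs over a nonempty coset, and by
  \<open>lmult_null\<close> all its members coincide; it is therefore the value at any
  representative.\<close>

lemma lact_T:
  assumes "a \<in> carrier A"
  shows "lact T a (cls x) = cls (tensor_lmult A a x)"
proof -
  have "cls (tensor_lmult A a y) = cls (tensor_lmult A a x)" if "y \<in> cls x" for y
    using that lmult_null[OF assms, of "y - x"] by (simp add: cls_mem cls_eq_iff tensor_mult_diff)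
  moreover have "cls x \<noteq> {}" using cls_mem[of x x] by auto
  moreover have "lact T a (cls x) = (\<Union>y\<in>cls x. cls (tensor_lmult A a y))"
    by (simp add: tensor_power_def monoid.defs bimodule.defs tensor_class_def tensor_lmult_def)
  ultimately show ?thesis by (simp add: SUP_eq_const)
qed

lemma ract_T:
  assumes "a \<in> carrier A"
  shows "ract T (cls x) a = cls (tensor_rmult A a x)"
proof -
  have "cls (tensor_rmult A a y) = cls (tensor_rmult A a x)" if "y \<in> cls x" for y
    using that rmult_null[OF assms, of "y - x"] by (simp add: cls_mem cls_eq_iff tensor_mult_diff)
  moreover have "cls x \<noteq> {}" using cls_mem[of x x] by auto
  moreover have "ract T (cls x) a = (\<Union>y\<in>cls x. cls (tensor_rmult A a y))"
    by (simp add: tensor_power_def monoid.defs bimodule.defs tensor_class_def tensor_rmult_def)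
  ultimately show ?thesis by (simp add: SUP_eq_const)
qed

text \<open>On a word this is an additivity relation in the first factor. It is a statement modulo
  \<open>N\<close>, whereas the associativity and unit laws below are equations in the free
  group.\<close>

lemma lmult_add_left:
  assumes a: "a \<in> carrier A" "a' \<in> carrier A" and "x \<in> carrier F"
  shows "tensor_lmult A (a \<oplus> a') x - (tensor_lmult A a x + tensor_lmult A a' x) \<in> N"
  using assms(3)
proof (induction rule: free_induct)
  case (word as)
  then obtain c bs where "as = c # bs" "c \<in> carrier A" "set bs \<subseteq> carrier A" "length bs = m - 1"
    by (rule word_cases)
  then show ?case
    using a null_additive[of "[]" bs "a \<otimes> c" "a' \<otimes> c"] m_pos
    by (simp add: l_distr diff_diff_add)
next
  case (diff x y)
  from null_diff[OF this] show ?case by (simp add: tensor_mult_diff algebra_simps)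
qed simp

lemma rmult_add_right:
  assumes a: "a \<in> carrier A" "a' \<in> carrier A" and "x \<in> carrier F"
  shows "tensor_rmult A (a \<oplus> a') x - (tensor_rmult A a x + tensor_rmult A a' x) \<in> N"
  using assms(3)
proof (induction rule: free_induct)
  case (word as)
  then obtain c bs where "as = bs @ [c]" "c \<in> carrier A" "set bs \<subseteq> carrier A" "length bs = m - 1"
    by (rule word_snoc_cases)
  then show ?case
    using a null_additive[of bs "[]" "c \<otimes> a" "c \<otimes> a'"] m_pos
    by (simp add: r_distr diff_diff_add)
next
  case (diff x y)
  from null_diff[OF this] show ?case by (simp add: tensor_mult_diff algebra_simps)
qed simp

lemma lmult_assoc:
  assumes a: "a \<in> carrier A" "a' \<in> carrier A" and "x \<in> carrier F"
  shows "tensor_lmult A (a \<otimes> a') x = tensor_lmult A a (tensor_lmult A a' x)"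
  using assms(3)
  by (induction rule: free_induct) (simp_all add: a word_parts m_assoc tensor_mult_diff)

lemma rmult_assoc:
  assumes a: "a \<in> carrier A" "a' \<in> carrier A" and "x \<in> carrier F"
  shows "tensor_rmult A (a \<otimes> a') x = tensor_rmult A a' (tensor_rmult A a x)"
  using assms(3)
  by (induction rule: free_induct) (simp_all add: a word_parts m_assoc tensor_mult_diff)

lemma mult_one:
  assumes "x \<in> carrier F"
  shows "tensor_lmult A \<one> x = x" "tensor_rmult A \<one> x = x"
  using assms
  by (induction rule: free_induct) (simp_all add: word_parts tensor_mult_diff)

lemma lmult_rmult:
  assumes a: "a \<in> carrier A" "b \<in> carrier A" and "x \<in> carrier F"
  shows "tensor_rmult A b (tensor_lmult A a x) = tensor_lmult A a (tensor_rmult A b x)"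
  using assms(3)
proof (induction rule: free_induct)
  case (word as)
  then obtain c bs where "as = c # bs" "c \<in> carrier A" "set bs \<subseteq> carrier A" "length bs = m - 1"
    by (rule word_cases)
  then show ?case
    \<comment> \<open>If \<open>bs\<close> is empty, a single factor is multiplied from both sides
      and ring associativity enters; otherwise the two multiplications affect different
      factors.\<close>
    by (cases bs rule: rev_cases) (auto simp: a m_assoc butlast_append)
qed (simp_all add: tensor_mult_diff)

lemma bimodule_tensor_power: "bimodule A A T"
proof -
  have "comm_group T"
    unfolding tensor_power_def
    by (intro comm_group_extend comm_group.abelian_FactGroup tensor_free_comm_group null_subgroup)
  then interpret T: comm_group T .
  note * = lact_T ract_T mult_T lmult_closed rmult_closed cls_eq_iff
  show ?thesis
  proof unfold_locales
    fix a b X Y assume "X \<in> carrier T" "Y \<in> carrier T" and ab: "a \<in> carrier A" "b \<in> carrier A"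
    then obtain x y where X: "X = cls x" and Y: "Y = cls y" and xy: "x \<in> carrier F" "y \<in> carrier F"
      by (auto simp: carrier_T)
    show "lact T a X \<in> carrier T" "ract T X b \<in> carrier T"
      using ab xy lmult_closed rmult_closed by (simp_all add: X lact_T ract_T carrier_T)
    show "lact T a (X \<otimes>\<^bsub>T\<^esub> Y) = lact T a X \<otimes>\<^bsub>T\<^esub> lact T a Y"
      and "ract T (X \<otimes>\<^bsub>T\<^esub> Y) b = ract T X b \<otimes>\<^bsub>T\<^esub> ract T Y b"
      using ab xy by (simp_all add: X Y * tensor_mult_add)
    show "lact T (a \<oplus> b) X = lact T a X \<otimes>\<^bsub>T\<^esub> lact T b X"
      and "ract T X (a \<oplus> b) = ract T X a \<otimes>\<^bsub>T\<^esub> ract T X b"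
      using ab xy by (simp_all add: X * lmult_add_left rmult_add_right)
    show "lact T (a \<otimes> b) X = lact T a (lact T b X)" "ract T X (a \<otimes> b) = ract T (ract T X a) b"
      using ab xy by (simp_all add: X * lmult_assoc rmult_assoc)
    show "ract T (lact T a X) b = lact T a (ract T X b)"
      using ab xy by (simp add: X * lmult_rmult)
  next
    fix X assume "X \<in> carrier T"
    then show "lact T \<one> X = X" "ract T X \<one> = X"
      by (auto simp: carrier_T lact_T ract_T mult_one)
  qed
qed

end

section \<open>Reduction of tensor powers modulo an ideal of the subring\<close>

text \<open>The quotient extension enters as the image of a ring surjection \<open>q\<close> with
  kernel \<open>I\<close>; cosets of \<open>I\<close> do not occur before the final section.\<close>

locale extension_reduction =
  E: tensor_extension A B m + E': tensor_extension A' B' m + q: ring_hom_ring A A' q + ideal I A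
  for A :: "('a, 'd) ring_scheme" (structure) and B :: "'a set" and m :: nat
    and A' :: "('b, 'e) ring_scheme" (structure) and B' :: "'b set"
    and q :: "'a \<Rightarrow> 'b" and I :: "'a set" +
  assumes I_subset: "I \<subseteq> B"
    and q_surj: "carrier A' = q ` carrier A"
    and q_sub: "B' = q ` B"
    and q_kernel: "a \<in> carrier A \<Longrightarrow> q a = \<zero>\<^bsub>A'\<^esub> \<longleftrightarrow> a \<in> I"
begin

definition \<phi> :: "('a list \<Rightarrow>\<^sub>0 int) \<Rightarrow> ('b list \<Rightarrow>\<^sub>0 int)"
  where "\<phi> = frag_extend (frag_of \<circ> map q)"

definition \<pi> :: "('a list \<Rightarrow>\<^sub>0 int) set \<Rightarrow> ('b list \<Rightarrow>\<^sub>0 int) set"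
  where "\<pi> X = (\<Union>x\<in>X. E'.cls (\<phi> x))"

text \<open>Preimages are chosen factor by factor with no regard to the ring operations;
  \<open>\<sigma>\<close> is additive because it is extended linearly from words.\<close>

definition \<sigma> :: "('b list \<Rightarrow>\<^sub>0 int) \<Rightarrow> ('a list \<Rightarrow>\<^sub>0 int)"
  where "\<sigma> = frag_extend (frag_of \<circ> map (inv_into (carrier A) q))"

section \<open>Compatibility of the lifted surjection with relations and actions\<close>

lemma \<phi>_simps [simp]: "\<phi> (frag_of as) = frag_of (map q as)" "\<phi> 0 = 0"
  by (simp_all add: \<phi>_def)

lemma \<phi>_diff: "\<phi> (x - y) = \<phi> x - \<phi> y" and \<phi>_add: "\<phi> (x + y) = \<phi> x + \<phi> y"
  by (simp_all add: \<phi>_def frag_extend_diff frag_extend_add)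

lemma \<sigma>_simps [simp]: "\<sigma> (frag_of as) = frag_of (map (inv_into (carrier A) q) as)" "\<sigma> 0 = 0"
  by (simp_all add: \<sigma>_def)

lemma \<sigma>_diff: "\<sigma> (x - y) = \<sigma> x - \<sigma> y"
  by (simp add: \<sigma>_def frag_extend_diff)

lemma section_closed: "a \<in> carrier A' \<Longrightarrow> inv_into (carrier A) q a \<in> carrier A"
  by (simp add: q_surj inv_into_into)

lemma section_right_inverse: "a \<in> carrier A' \<Longrightarrow> q (inv_into (carrier A) q a) = a"
  by (simp add: q_surj f_inv_into_f)

lemma \<phi>_closed:
  assumes "x \<in> carrier E.F" shows "\<phi> x \<in> carrier E'.F"
  using assms unfolding carrier_tensor_free \<phi>_def mem_Collect_eq
  by (rule keys_frag_extend_subset) auto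

lemma \<phi>_null: "x \<in> E.N \<Longrightarrow> \<phi> x \<in> E'.N"
proof (induction rule: E.null_induct)
  case (rel x)
  then show ?case
  proof cases
    case (additive us vs c c')
    then have "q ` set us \<subseteq> carrier A'" "q ` set vs \<subseteq> carrier A'" by auto
    then show ?thesis
      using additive E'.null_additive[of "map q us" "map q vs" "q c" "q c'"]
      by (simp add: \<phi>_diff)
  next
    case (balanced us vs c c' b)
    then have "q ` set us \<subseteq> carrier A'" "q ` set vs \<subseteq> carrier A'" by auto
    then show ?thesis
      using balanced E'.null_balanced[of "map q us" "map q vs" "q c" "q c'" "q b"]
      by (simp add: \<phi>_diff q_sub E.B_sub)
  qed
qed (simp_all add: \<phi>_diff E'.null_diff)

lemma \<pi>_cls: "\<pi> (E.cls x) = E'.cls (\<phi> x)"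
proof -
  have "E'.cls (\<phi> y) = E'.cls (\<phi> x)" if "y \<in> E.cls x" for y
    using that \<phi>_null[of "y - x"] by (simp add: E.cls_mem E'.cls_eq_iff \<phi>_diff)
  moreover have "E.cls x \<noteq> {}" using E.cls_mem[of x x] by auto
  ultimately show ?thesis unfolding \<pi>_def by (intro SUP_eq_const)
qed

lemma \<phi>_lmult:
  assumes a: "a \<in> carrier A" and "x \<in> carrier E.F"
  shows "\<phi> (tensor_lmult A a x) = tensor_lmult A' (q a) (\<phi> x)"
  using assms(2)
  by (induction rule: E.free_induct)
    (simp_all add: a E.word_parts hd_map map_tl \<phi>_diff tensor_mult_diff)

lemma \<phi>_rmult:
  assumes a: "a \<in> carrier A" and "x \<in> carrier E.F"
  shows "\<phi> (tensor_rmult A a x) = tensor_rmult A' (q a) (\<phi> x)"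
  using assms(2)
  by (induction rule: E.free_induct)
    (simp_all add: a E.word_parts last_map map_butlast \<phi>_diff tensor_mult_diff)

text \<open>\<open>W\<close> is the preimage of \<open>IC + CI\<close> in the free group.  The additive section \<open>\<sigma>\<close> of \<open>\<phi>\<close> does not
  respect the tensor relations, but it does so modulo \<open>W\<close>, whence the kernel of \<open>\<phi>\<close> modulo the
  relations is contained in \<open>W\<close>.\<close>

definition W :: "('a list \<Rightarrow>\<^sub>0 int) set"
  where "W = {x \<in> carrier E.F. E.cls x \<in> generate E.T (bimod_ideal_gens I E.T)}"

interpretation T: bimodule A A E.T by (rule E.bimodule_tensor_power)
interpretation T': bimodule A' A' E'.T by (rule E'.bimodule_tensor_power)

lemma ideal_gens_subset: "bimod_ideal_gens I E.T \<subseteq> carrier E.T"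
  using a_subset by (auto simp: bimod_ideal_gens_def T.lact_closed T.ract_closed)

section \<open>Exchange of tensor factors modulo \<open>W\<close>\<close>

lemma W_diff:
  assumes "x \<in> W" "y \<in> W" shows "x - y \<in> W"
proof -
  let ?J = "generate E.T (bimod_ideal_gens I E.T)"
  have J: "subgroup ?J E.T"
    by (rule T.M.generate_is_subgroup[OF ideal_gens_subset])
  have x: "x \<in> carrier E.F" "E.cls x \<in> ?J" and y: "y \<in> carrier E.F" "E.cls y \<in> ?J"
    using assms by (auto simp: W_def)
  have xy: "x - y \<in> carrier E.F" using E.diff_closed_F x y by blast
  \<comment> \<open>\<open>mult_T\<close> speaks of sums, so the coset of a difference is found by
    solving this product for its first factor.\<close>
  have "E.cls (x - y) \<otimes>\<^bsub>E.T\<^esub> E.cls y = E.cls x"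
    using E.mult_T[OF xy y(1)] by simp
  then have "E.cls (x - y) = E.cls x \<otimes>\<^bsub>E.T\<^esub> inv\<^bsub>E.T\<^esub> E.cls y"
    using x(1) y(1) xy by (intro T.M.inv_solve_right[THEN iffD2]) (auto simp: E.carrier_T)
  then have "E.cls (x - y) \<in> ?J"
    using subgroup.m_closed[OF J x(2) subgroup.m_inv_closed[OF J y(2)]] by simp
  then show ?thesis using xy by (simp add: W_def)
qed

lemma W_null: assumes "x \<in> E.N" shows "x \<in> W"
proof -
  have "E.cls x = E.cls 0" using assms by (simp add: E.cls_eq_iff)
  then show ?thesis
    using generate.one[of E.T] E.null_subset[OF assms] by (simp add: W_def E.one_T)
qed

lemma W_cong: "\<lbrakk>x - y \<in> W; y \<in> W\<rbrakk> \<Longrightarrow> x \<in> W"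
  using W_diff[of "x - y" "0 - y"] W_diff[of 0 y] W_null[of 0] by simp

text \<open>As \<open>i \<in> I \<subseteq> B\<close>, we have \<open>a \<otimes> i = ai \<otimes> 1\<close> with \<open>ai \<in> I\<close>, so that a factor from \<open>I\<close> moves
  to the front.\<close>

lemma W_factor:
  assumes "i \<in> I" "length us + 1 + length vs = m" "set us \<subseteq> carrier A" "set vs \<subseteq> carrier A"
  shows "frag_of (us @ [i] @ vs) \<in> W"
  using assms
\<comment> \<open>\<open>i\<close> and \<open>vs\<close> vary because each move replaces them by
  \<open>a \<otimes> i\<close> and \<open>\<one> # vs\<close>.\<close>
proof (induction us arbitrary: i vs rule: rev_induct)
  case Nil
  have i: "i \<in> carrier A" using Nil.prems(1) by (rule a_Hcarr)
  have c: "frag_of (\<one> # vs) \<in> carrier E.F" "frag_of (i # vs) \<in> carrier E.F"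
    using Nil.prems i by (simp_all add: carrier_tensor_free)
  then have "E.cls (frag_of (\<one> # vs)) \<in> carrier E.T"
    unfolding E.carrier_T by blast
  \<comment> \<open>A tensor with \<open>i\<close> in front is \<open>i\<close> times the tensor
    with \<one> in front, hence a generator of IC.\<close>
  then have "lact E.T i (E.cls (frag_of (\<one> # vs))) \<in> bimod_ideal_gens I E.T"
    unfolding bimod_ideal_gens_def using Nil.prems(1) by blast
  moreover have "lact E.T i (E.cls (frag_of (\<one> # vs))) = E.cls (frag_of (i # vs))"
    using i by (simp add: E.lact_T)
  ultimately have "E.cls (frag_of (i # vs)) \<in> bimod_ideal_gens I E.T" by simp
  then show ?case using c by (simp add: W_def generate.incl del: E.frag_of_closed_F)
next
  case (snoc a us)
  have i: "i \<in> carrier A" "i \<in> B" using snoc.prems(1) I_subset by (auto simp: a_Hcarr)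
  have a: "a \<in> carrier A" "set us \<subseteq> carrier A" using snoc.prems by auto
  have w: "frag_of (us @ [a \<otimes> i] @ (\<one> # vs)) \<in> W"
    using snoc.prems a by (intro snoc.IH) (auto simp: I_l_closed)
  have "frag_of (us @ [a \<otimes> i] @ (\<one> # vs)) - frag_of ((us @ [a]) @ [i] @ vs) \<in> E.N"
    using E.null_balanced[of us vs a \<one> i] snoc.prems a i by simp
  from W_diff[OF w W_null[OF this]] show ?case by simp
qed

text \<open>The difference u - v lies in the kernel of \<open>q\<close>, which is \<open>I\<close>.
  Additivity in this slot splits the word along u = (u - v) + v, and the part with u - v lies in
  \<open>W\<close> by \<open>W_factor\<close>.\<close>

lemma W_replace_factor:
  assumes "length ws + 1 + length us = m" "set ws \<subseteq> carrier A" "set us \<subseteq> carrier A"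
    and u: "u \<in> carrier A" and v: "v \<in> carrier A" and uv: "q u = q v"
  shows "frag_of (ws @ [u] @ us) - frag_of (ws @ [v] @ us) \<in> W"
proof -
  have "q (u \<ominus> v) = \<zero>\<^bsub>A'\<^esub>"
    using u v uv by (simp add: a_minus_def q.hom_add q.hom_a_inv E'.r_neg)
  then have i: "u \<ominus> v \<in> I" using u v q_kernel by simp
  have "(u \<ominus> v) \<oplus> v = u" using u v by (simp add: a_minus_def E.a_assoc E.l_neg)
  then have "frag_of (ws @ [u] @ us) - frag_of (ws @ [u \<ominus> v] @ us) - frag_of (ws @ [v] @ us) \<in> E.N"
    using E.null_additive[OF assms(1-3), of "u \<ominus> v" v] u v by simp
  then have "(frag_of (ws @ [u] @ us) - frag_of (ws @ [v] @ us)) - frag_of (ws @ [u \<ominus> v] @ us) \<in> W"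
    using W_null by (simp add: algebra_simps)
  then show ?thesis
    by (rule W_cong) (rule W_factor[OF i assms(1-3)])
qed

text \<open>One factor is exchanged at a time; \<open>ws\<close> collects the prefix already
  treated.\<close>

lemma W_replace:
  assumes "length us = length vs" "map q us = map q vs" "length ws + length us = m"
    "set ws \<subseteq> carrier A" "set us \<subseteq> carrier A" "set vs \<subseteq> carrier A"
  shows "frag_of (ws @ us) - frag_of (ws @ vs) \<in> W"
  using assms
proof (induction us vs arbitrary: ws rule: list_induct2)
  case Nil
  then show ?case using W_null[of 0] by simp
next
  case (Cons u us v vs)
  have "frag_of (ws @ [u] @ us) - frag_of (ws @ [v] @ us) \<in> W"
    using Cons.prems by (intro W_replace_factor) auto
  moreover have "frag_of ((ws @ [v]) @ us) - frag_of ((ws @ [v]) @ vs) \<in> W"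
    using Cons.prems by (intro Cons.IH) auto
  then have "0 - (frag_of ((ws @ [v]) @ us) - frag_of ((ws @ [v]) @ vs)) \<in> W"
    by (rule W_diff[OF W_null[OF E.null_zero]])
  ultimately show ?case using W_diff by fastforce
qed

lemma W_replace_words:
  assumes "us \<in> tensor_words A m" "vs \<in> tensor_words A m" "map q us = map q vs"
  shows "frag_of us - frag_of vs \<in> W"
  using W_replace[of us vs "[]"] assms by simp

text \<open>A word and the word rebuilt from its image agree under \<open>q\<close> in every factor,
  so they can be exchanged modulo \<open>W\<close>.\<close>

lemma W_section: "x \<in> carrier E.F \<Longrightarrow> x - \<sigma> (\<phi> x) \<in> W"
proof (induction rule: E.free_induct)
  case (word as)
  then have "map q as = map q (map (inv_into (carrier A) q) (map q as))"
    by (auto simp: section_right_inverse subset_iff)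
  moreover have "map (inv_into (carrier A) q) (map q as) \<in> tensor_words A m"
    using word by (auto intro!: section_closed)
  ultimately show ?case
    using W_replace_words[OF word] by simp
next
  case (diff x y)
  then show ?case using W_diff[OF diff] by (simp add: \<sigma>_diff \<phi>_diff algebra_simps)
qed (use W_null[of 0] in simp)

text \<open>With s the chosen section of \<open>q\<close>, a lifted relation contains s (c + c')
  where a relation over \<open>A\<close> has s c + s c'. Both have the same image under
  \<open>q\<close>, so \<open>W_replace_factor\<close> exchanges them; products are treated
  alike.\<close>

lemma W_section_null: "y \<in> E'.N \<Longrightarrow> \<sigma> y \<in> W"
proof (induction rule: E'.null_induct)
  case (rel x)
  let ?s = "inv_into (carrier A) q"
  note [simp] = section_closed section_right_inverse
  have sec: "set (map ?s us) \<subseteq> carrier A" "map (q \<circ> ?s) us = us"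
    if "set us \<subseteq> carrier A'" for us
    using that by (auto simp: subset_iff intro!: map_idI)
  from rel show ?case
  proof cases
    case (additive us vs c c')
    note s = sec[OF additive(3)] sec[OF additive(4)]
    let ?u = "map ?s us" and ?v = "map ?s vs"
    have 1: "frag_of (?u @ [?s (c \<oplus>\<^bsub>A'\<^esub> c')] @ ?v) - frag_of (?u @ [?s c \<oplus> ?s c'] @ ?v) \<in> W"
      using additive s by (intro W_replace_factor) auto
    have 2: "frag_of (?u @ [?s c \<oplus> ?s c'] @ ?v) - frag_of (?u @ [?s c] @ ?v)
        - frag_of (?u @ [?s c'] @ ?v) \<in> W"
      using additive s by (intro W_null E.null_additive) auto
    have "\<sigma> x = frag_of (?u @ [?s (c \<oplus>\<^bsub>A'\<^esub> c')] @ ?v) - frag_of (?u @ [?s c] @ ?v)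
        - frag_of (?u @ [?s c'] @ ?v)"
      using additive by (simp add: \<sigma>_diff)
    then have "\<sigma> x - (frag_of (?u @ [?s c \<oplus> ?s c'] @ ?v) - frag_of (?u @ [?s c] @ ?v)
        - frag_of (?u @ [?s c'] @ ?v)) \<in> W"
      using 1 by simp
    then show ?thesis using 2 by (rule W_cong)
  next
    case (balanced us vs c c' b')
    \<comment> \<open>In \<open>\<sigma> x\<close> the scalar \<open>b'\<close> occurs only inside
      products, so it can be lifted to an element of \<open>B\<close>, as a balancing relation over
      \<open>A\<close> requires, independently of the section.\<close>
    then obtain b where b: "b \<in> B" "b' = q b" by (auto simp: q_sub)
    note s = sec[OF balanced(3)] sec[OF balanced(4)]
    let ?u = "map ?s us" and ?v = "map ?s vs"
    have 1: "frag_of (?u @ [?s (c \<otimes>\<^bsub>A'\<^esub> b')] @ (?s c' # ?v))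
        - frag_of (?u @ [?s c \<otimes> b] @ (?s c' # ?v)) \<in> W"
      using balanced s b by (intro W_replace_factor) (auto simp: E.B_sub E'.B_sub)
    have 2: "frag_of ((?u @ [?s c]) @ [?s (b' \<otimes>\<^bsub>A'\<^esub> c')] @ ?v)
        - frag_of ((?u @ [?s c]) @ [b \<otimes> ?s c'] @ ?v) \<in> W"
      using balanced s b by (intro W_replace_factor) (auto simp: E.B_sub E'.B_sub)
    have 3: "frag_of (?u @ [?s c \<otimes> b, ?s c'] @ ?v) - frag_of (?u @ [?s c, b \<otimes> ?s c'] @ ?v) \<in> W"
      using balanced s b by (intro W_null E.null_balanced) auto
    have eq: "\<sigma> x = frag_of (?u @ [?s (c \<otimes>\<^bsub>A'\<^esub> b')] @ (?s c' # ?v))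
        - frag_of ((?u @ [?s c]) @ [?s (b' \<otimes>\<^bsub>A'\<^esub> c')] @ ?v)"
      using balanced by (simp add: \<sigma>_diff)
    have "\<sigma> x - (frag_of (?u @ [?s c \<otimes> b, ?s c'] @ ?v)
        - frag_of (?u @ [?s c, b \<otimes> ?s c'] @ ?v)) \<in> W"
      unfolding eq using W_diff[OF 1 2] by (simp add: algebra_simps)
    then show ?thesis using 3 by (rule W_cong)
  qed
qed (use W_null[of 0] W_diff in \<open>simp_all add: \<sigma>_diff\<close>)

text \<open>Carried out over \<open>A\<close> on both sides; the bimodules in the depth conditions
  arise from this by restriction of scalars.\<close>

lemma bimod_reduction_tensor_power: "bimod_reduction A A A' A' q I E.T E'.T \<pi>"
proof -
  interpret \<pi>: group_hom E.T E'.T \<pi>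
  proof (unfold_locales, rule homI)
    fix X Y assume "X \<in> carrier E.T" "Y \<in> carrier E.T"
    then obtain x y where X: "X = E.cls x" and Y: "Y = E.cls y"
      and xy: "x \<in> carrier E.F" "y \<in> carrier E.F"
      by (auto simp: E.carrier_T)
    then show "\<pi> X \<in> carrier E'.T" "\<pi> (X \<otimes>\<^bsub>E.T\<^esub> Y) = \<pi> X \<otimes>\<^bsub>E'.T\<^esub> \<pi> Y"
      by (simp_all add: E'.carrier_T \<pi>_cls \<phi>_closed E.mult_T E'.mult_T \<phi>_add)
  qed
  have "E'.cls ` carrier E'.F \<subseteq> \<pi> ` carrier E.T"
  proof
    fix Y assume "Y \<in> E'.cls ` carrier E'.F"
    then obtain y where y: "y \<in> carrier E'.F" "Y = E'.cls y" by blast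
    have "\<exists>x \<in> carrier E.F. \<phi> x = y"
      using y(1)
    proof (induction rule: E'.free_induct)
      case zero
      show ?case by (rule bexI[of _ 0]) (simp_all add: carrier_tensor_free)
    next
      case (word as)
      then have "map (q \<circ> inv_into (carrier A) q) as = as"
        by (auto simp: section_right_inverse subset_iff intro!: map_idI)
      then show ?case
        using word by (intro bexI[of _ "\<sigma> (frag_of as)"])
          (auto simp: carrier_tensor_free section_closed subset_iff)
    next
      case (diff x y)
      then show ?case by (metis E.diff_closed_F \<phi>_diff)
    qed
    then obtain x where "x \<in> carrier E.F" "\<phi> x = y" by blast
    then show "Y \<in> \<pi> ` carrier E.T"
      by (intro image_eqI[of _ _ "E.cls x"]) (auto simp: y E.carrier_T \<pi>_cls)
  qed
  then have surj: "carrier E'.T = \<pi> ` carrier E.T"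
    using \<pi>.hom_closed by (auto simp: E'.carrier_T)
  have l: "\<pi> (lact E.T a x) = lact E'.T (q a) (\<pi> x)" if "a \<in> carrier A" "x \<in> carrier E.T" for a x
    using that by (auto simp: E.carrier_T E.lact_T E'.lact_T \<pi>_cls \<phi>_lmult)
  have r: "\<pi> (ract E.T x a) = ract E'.T (\<pi> x) (q a)" if "x \<in> carrier E.T" "a \<in> carrier A" for a x
    using that by (auto simp: E.carrier_T E.ract_T E'.ract_T \<pi>_cls \<phi>_rmult)
  have "kernel E.T E'.T \<pi> \<subseteq> generate E.T (bimod_ideal_gens I E.T)"
  proof
    fix X assume "X \<in> kernel E.T E'.T \<pi>"
    then obtain x where x: "x \<in> carrier E.F" "X = E.cls x" "E'.cls (\<phi> x) = E'.cls 0"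
      by (auto simp: kernel_def E.carrier_T \<pi>_cls E'.one_T)
    then have "\<phi> x \<in> E'.N" by (simp add: E'.cls_eq_iff)
    \<comment> \<open>Here x = (x - \<sigma> (\<phi> x)) + \<sigma> (\<phi> x), and both terms lie
      in \<open>W\<close>.\<close>
    then have "x \<in> W"
      using W_cong[OF W_section[OF x(1)] W_section_null] by blast
    then show "X \<in> generate E.T (bimod_ideal_gens I E.T)"
      by (simp add: W_def x)
  qed
  moreover have "generate E.T (bimod_ideal_gens I E.T) \<subseteq> kernel E.T E'.T \<pi>"
    using q_kernel a_Hcarr
    by (intro bimod_reduction_kernel_supset[OF T.bimodule_axioms T'.bimodule_axioms
          \<pi>.group_hom_axioms a_subset a_subset l r]) auto
  ultimately show ?thesis
    using surj l r a_subset q_surj by unfold_locales auto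
qed

end

section \<open>Depth of the reduced extension\<close>

lemma base_bimodule_simps [simp]:
  "carrier (base_bimodule A B) = B"
  "mult (base_bimodule A B) = add A"
  "one (base_bimodule A B) = \<zero>\<^bsub>A\<^esub>"
  "lact (base_bimodule A B) = mult A"
  "ract (base_bimodule A B) = mult A"
  by (simp_all add: base_bimodule_def monoid.defs bimodule.defs)

lemma bimodule_base:
  assumes "ring A" "subring B A"
  shows "bimodule (sub_ring A B) (sub_ring A B) (base_bimodule A B)"
proof -
  interpret ring A by fact
  interpret B: subring B A by fact
  interpret R: ring "sub_ring A B" using subring_is_ring[OF assms(2)] .
  have "comm_group \<lparr>carrier = B, mult = add A, one = \<zero>\<^bsub>A\<^esub>\<rparr>"
  proof (rule comm_groupI; simp)
    show "\<exists>y\<in>B. y \<oplus>\<^bsub>A\<^esub> x = \<zero>\<^bsub>A\<^esub>" if "x \<in> B" for x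
      using that subringE(1,5)[OF assms(2)] by (intro bexI[of _ "\<ominus>\<^bsub>A\<^esub> x"]) (auto simp: l_neg)
  qed (use subringE[OF assms(2)] in \<open>auto simp: a_ac subset_iff\<close>)
  then interpret M: comm_group "base_bimodule A B"
    unfolding base_bimodule_def by (rule comm_group_extend)
  show ?thesis
    by unfold_locales
      (auto simp: l_distr r_distr m_assoc dest: B.subset[THEN subsetD])
qed

context extension_reduction begin

lemma sub_rings: "ring (sub_ring A B)" "ring (sub_ring A' B')"
  using E.subring_is_ring[OF E.subring_axioms] E'.subring_is_ring[OF E'.subring_axioms] by auto

text \<open>Since \<one> lies in \<open>B\<close>, each i in \<open>I\<close> is the generator i
  \<one>. So IB + BI is \<open>I\<close>, which is also the kernel of \<open>q\<close> on
  \<open>B\<close>.\<close>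

lemma bimod_reduction_base:
  "bimod_reduction (sub_ring A B) (sub_ring A B) (sub_ring A' B') (sub_ring A' B') q I
    (base_bimodule A B) (base_bimodule A' B') q"
proof -
  interpret M: bimodule "sub_ring A B" "sub_ring A B" "base_bimodule A B"
    by (rule bimodule_base[OF E.ring_axioms E.subring_axioms])
  interpret M': bimodule "sub_ring A' B'" "sub_ring A' B'" "base_bimodule A' B'"
    by (rule bimodule_base[OF E'.ring_axioms E'.subring_axioms])
  interpret q': group_hom "base_bimodule A B" "base_bimodule A' B'" q
    by unfold_locales (auto simp: hom_def q_sub E.B_sub)
  have "kernel (base_bimodule A B) (base_bimodule A' B') q = I"
    using q_kernel I_subset E.B_sub by (auto simp: kernel_def)
  moreover have "bimod_ideal_gens I (base_bimodule A B) = I"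
  proof
    show "bimod_ideal_gens I (base_bimodule A B) \<subseteq> I"
      by (auto simp: bimod_ideal_gens_def I_l_closed I_r_closed E.B_sub)
    show "I \<subseteq> bimod_ideal_gens I (base_bimodule A B)"
    proof
      fix i assume i: "i \<in> I"
      then have "lact (base_bimodule A B) i \<one> \<in> bimod_ideal_gens I (base_bimodule A B)"
        unfolding bimod_ideal_gens_def using i
        by (intro UnI1 UN_I[of i] image_eqI[of _ _ \<one>]) simp_all
      then show "i \<in> bimod_ideal_gens I (base_bimodule A B)"
        using i a_Hcarr by simp
    qed
  qed
  moreover have "generate (base_bimodule A B) I = I"
  proof -
    \<comment> \<open>\<open>calculation(1)\<close> is the first collected fact, that the kernel is
      \<open>I\<close>; thus \<open>I\<close> is a subgroup because kernels are.\<close>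
    have "subgroup I (base_bimodule A B)"
      using q'.subgroup_kernel by (simp add: calculation(1))
    then show ?thesis
      by (intro equalityI M.M.generate_subgroup_incl) (auto intro: generate.incl)
  qed
  ultimately show ?thesis
    using I_subset by unfold_locales (auto simp: q_sub E.B_sub)
qed

lemma bimod_reduction_tensor_power_sub:
  shows "bimod_reduction (sub_ring A B) (sub_ring A B) (sub_ring A' B') (sub_ring A' B') q I
      E.T E'.T \<pi>"
    and "bimod_reduction A (sub_ring A B) A' (sub_ring A' B') q I E.T E'.T \<pi>"
    and "bimod_reduction (sub_ring A B) A (sub_ring A' B') A' q I E.T E'.T \<pi>"
  using sub_rings E.ring_axioms E'.ring_axioms I_subset a_subset q_surj q_sub E.subset
  by - (rule bimod_reduction_restrict_scalars[OF bimod_reduction_tensor_power]; simp)+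

end

lemma zero_FactRing: "\<zero>\<^bsub>A Quot I\<^esub> = I"
  by (simp add: FactRing_def)

lemma carrier_FactRing: "carrier (A Quot I) = (+>\<^bsub>A\<^esub>) I ` carrier A"
  by (auto simp: FactRing_simps)

lemma extension_reduction_Quot:
  assumes "ring A" "subring B A" "ideal I A" "I \<subseteq> B" "0 < m"
  shows "extension_reduction A B m (A Quot I) (quot_image A B I) ((+>\<^bsub>A\<^esub>) I) I"
proof -
  interpret A: ring A by fact
  interpret B: subring B A by fact
  interpret I: ideal I A by fact
  interpret q: ring_hom_ring A "A Quot I" "(+>\<^bsub>A\<^esub>) I" by (rule I.rcos_ring_hom_ring)
  interpret B': subring "quot_image A B I" "A Quot I"
    unfolding quot_image_def by (rule q.img_is_subring) fact
  show ?thesis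
  proof unfold_locales
    show "I +>\<^bsub>A\<^esub> a = \<zero>\<^bsub>A Quot I\<^esub> \<longleftrightarrow> a \<in> I" if "a \<in> carrier A" for a
      unfolding zero_FactRing using I.a_rcos_const I.rcos_const_imp_mem[OF that] by metis
    show "carrier (A Quot I) = (+>\<^bsub>A\<^esub>) I ` carrier A"
      by (rule carrier_FactRing)
  qed (rule assms(4,5) quot_image_def)+
qed

text \<open>Left and right depth are kept apart, since \<open>min_depth\<close> accepts either of
  them.\<close>

lemma depth_descends:
  assumes "ring A" "subring B A" "ideal I A" "I \<subseteq> B"
  shows "has_depth_odd A B n \<Longrightarrow> has_depth_odd (A Quot I) (quot_image A B I) n"
    and "has_right_depth_even A B n \<Longrightarrow> has_right_depth_even (A Quot I) (quot_image A B I) n"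
    and "has_left_depth_even A B n \<Longrightarrow> has_left_depth_even (A Quot I) (quot_image A B I) n"
proof -
  note red = extension_reduction_Quot[OF assms]
  note base = extension_reduction.bimod_reduction_base[OF red[OF zero_less_one]]
  note tp = extension_reduction.bimod_reduction_tensor_power_sub[OF red]
  \<comment> \<open>For \<open>n = 0\<close> the first tensor power is compared with
    \<open>B\<close> itself, whence the separate use of \<open>base\<close>.\<close>
  show "has_depth_odd A B n \<Longrightarrow> has_depth_odd (A Quot I) (quot_image A B I) n"
    using H_equivalent_descends[OF tp(1) base, of 1]
      H_equivalent_descends[OF tp(1) tp(1), of "n + 1" n]
    by (auto simp: has_depth_odd_def split: if_splits)
  show "has_right_depth_even A B n \<Longrightarrow> has_right_depth_even (A Quot I) (quot_image A B I) n"
    using H_equivalent_descends[OF tp(2) tp(2), of "n + 1" n]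
    by (auto simp: has_right_depth_even_def)
  show "has_left_depth_even A B n \<Longrightarrow> has_left_depth_even (A Quot I) (quot_image A B I) n"
    using H_equivalent_descends[OF tp(3) tp(3), of "n + 1" n]
    by (auto simp: has_left_depth_even_def)
qed

theorem theorem3p6:
  fixes K :: "('k, 'c) ring_scheme" and A :: "('k, 'a, 'd) module_scheme"
    and B I :: "'a set"
  assumes "algebra_extension K A B"
    and "ideal I A"
    and "I \<subseteq> B"
  shows "(\<forall>n. has_depth_odd A B n \<longrightarrow> has_depth_odd (A Quot I) (quot_image A B I) n) \<and>
    (\<forall>n \<ge> 1. has_depth_even A B n \<longrightarrow> has_depth_even (A Quot I) (quot_image A B I) n) \<and>
    min_depth (quot_image A B I) (A Quot I) \<le> min_depth B A"
proof -
  interpret algebra_extension K A B by fact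
  note descends = depth_descends[OF A.ring_axioms subring_axioms assms(2,3)]
  \<comment> \<open>Each number counted for the extension is also counted for its quotient, so the
    left infimum runs over a superset.\<close>
  have "min_depth (quot_image A B I) (A Quot I) \<le> min_depth B A"
    unfolding min_depth_def using descends by (intro Inf_superset_mono) blast
  then show ?thesis
    using descends by (auto simp: has_depth_even_def)
qed

end
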